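(* Let $\pi(\mathcal{H}(r))$ denote the Turán density of the $r$-triangle $\mathcal{H}(r)$. Then $$\frac{9}{64} \le \pi(\mathcal{H}(6)), \qquad \frac{35}{2^{11}} \le \pi(\mathcal{H}(7)), \qquad \frac{315}{2^{14}} \le \pi(\mathcal{H}(8)).$$ Moreover, there exists a $5$-$(12,6,2)$ design with the property that any set of $7$ vertices spans $0$ or $2$ edges, and consequently $\operatorname{ex}(\mathcal{H}(6),12)=264$.
   Context: For $r\ge 2$, an $r$-graph is an $r$-uniform hypergraph. The $r$-triangle $\mathcal{H}(r)$ is the (unique up to isomorphism) $r$-graph on $r+1$ vertices with exactly $3$ edges. For an $r$-graph $\mathcal{H}$ and integer $n$, $\operatorname{ex}(\mathcal{H},n)$ is the maximum number of edges in an $r$-graph on $n$ vertices containing no copy of $\mathcal{H}$, and the Turán density is $\pi(\mathcal{H})=\lim_{n\to\infty}\operatorname{ex}(\mathcal{H},n)\binom{n}{r}^{-1}$. A $t$-$(n,k,\lambda)$ design is a $k$-graph on $n$ vertices in which every set of $t$ vertices is contained in exactly $\lambda$ edges. A set $S$ of vertices spans $m$ edges if exactly $m$ edges are contained in $S$. *)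

theory Defs
  imports Complex_Main
begin

type_synonym 'a hypergraph = "'a set \<times> 'a set set"

abbreviation verts :: "'a hypergraph \<Rightarrow> 'a set" where
  "verts G \<equiv> fst G"

abbreviation edges :: "'a hypergraph \<Rightarrow> 'a set set" where
  "edges G \<equiv> snd G"

definition r_graph :: "nat \<Rightarrow> 'a hypergraph \<Rightarrow> bool" where
  "r_graph r G \<longleftrightarrow>
     2 \<le> r \<and> finite (verts G) \<and> (\<forall>e\<in>edges G. e \<subseteq> verts G \<and> card e = r)"

text \<open>A copy is a not necessarily induced sub-hypergraph.\<close>

definition contains_copy :: "'a hypergraph \<Rightarrow> 'b hypergraph \<Rightarrow> bool" where
  "contains_copy G H \<longleftrightarrow>
     (\<exists>f. inj_on f (verts H) \<and> f ` verts H \<subseteq> verts G \<and> (\<forall>e\<in>edges H. f ` e \<in> edges G))"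

text \<open>The uniformity \<open>r\<close> of \<open>H\<close> is an explicit argument. Hosts have their vertices among the
  natural numbers, which loses nothing up to isomorphism.\<close>

definition turan_number :: "nat \<Rightarrow> 'a hypergraph \<Rightarrow> nat \<Rightarrow> nat" where
  "turan_number r H n =
     Max {card (edges G) | G :: nat hypergraph.
            r_graph r G \<and> card (verts G) = n \<and> \<not> contains_copy G H}"

definition turan_density :: "nat \<Rightarrow> 'a hypergraph \<Rightarrow> real" where
  "turan_density r H = lim (\<lambda>n. real (turan_number r H n) / real (n choose r))"

text \<open>The representative of the \<open>r\<close>-triangle on the vertices \<open>0, \<dots>, r\<close>; for its uniqueness up
  to isomorphism see \<open>r_triangle_unique\<close> below.\<close>

definition r_triangle :: "nat \<Rightarrow> nat hypergraph" where
  "r_triangle r = ({..r}, (\<lambda>i. {..r} - {i}) ` {0, 1, 2})"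

definition spans :: "'a hypergraph \<Rightarrow> 'a set \<Rightarrow> nat \<Rightarrow> bool" where
  "spans G S m \<longleftrightarrow> card {e \<in> edges G. e \<subseteq> S} = m"

definition design :: "nat \<Rightarrow> nat \<Rightarrow> nat \<Rightarrow> nat \<Rightarrow> 'a hypergraph \<Rightarrow> bool" where
  "design t n k l G \<longleftrightarrow>
     r_graph k G \<and> card (verts G) = n \<and>
     (\<forall>T. T \<subseteq> verts G \<and> card T = t \<longrightarrow> card {e \<in> edges G. T \<subseteq> e} = l)"

lemma inj_on_complement: "inj_on (\<lambda>i. V - {i}) V"
  by (rule inj_onI) blast

lemma r_triangle_is_r_triangle:
  assumes "2 \<le> r"
  shows "r_graph r (r_triangle r)" "card (verts (r_triangle r)) = r + 1"
    "card (edges (r_triangle r)) = 3"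
proof -
  show "r_graph r (r_triangle r)"
    using assms by (auto simp: r_graph_def r_triangle_def)
  show "card (verts (r_triangle r)) = r + 1"
    by (simp add: r_triangle_def)
  have "inj_on (\<lambda>i. {..r} - {i}) {0, 1, 2}"
    by (rule inj_on_subset[OF inj_on_complement]) (use assms in auto)
  then show "card (edges (r_triangle r)) = 3"
    unfolding r_triangle_def snd_conv by (subst card_image) auto
qed

lemma r_triangle_unique:
  fixes G :: "'a hypergraph"
  assumes G: "r_graph r G" "card (verts G) = r + 1" "card (edges G) = 3"
  shows "\<exists>f. bij_betw f (verts (r_triangle r)) (verts G) \<and>
             edges G = (\<lambda>e. f ` e) ` edges (r_triangle r)"
proof -
  have r: "2 \<le> r" and fin: "finite (verts G)"
    using G(1) by (auto simp: r_graph_def)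
  define X where "X = {x \<in> verts G. verts G - {x} \<in> edges G}"
  have Xsub: "X \<subseteq> verts G" by (auto simp: X_def)
  have E: "edges G = (\<lambda>x. verts G - {x}) ` X"
  proof
    show "edges G \<subseteq> (\<lambda>x. verts G - {x}) ` X"
    proof
      fix e assume e: "e \<in> edges G"
      then have sub: "e \<subseteq> verts G" and ce: "card e = r"
        using G(1) by (auto simp: r_graph_def)
      have "card (verts G - e) = 1"
        using card_Diff_subset[OF finite_subset[OF sub fin] sub] ce G(2) by simp
      then obtain x where "verts G - e = {x}" by (auto simp: card_1_singleton_iff)
      then have "x \<in> verts G" "e = verts G - {x}" using sub by auto
      then show "e \<in> (\<lambda>x. verts G - {x}) ` X" using e by (auto simp: X_def)
    qed
  qed (auto simp: X_def)
  have cX: "card X = 3"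
    using G(3) unfolding E by (simp add: card_image inj_on_subset[OF inj_on_complement Xsub])
  have finX: "finite X" using fin Xsub finite_subset by blast
  have "card {0, 1, 2::nat} = card X" using cX by simp
  then obtain g where g: "bij_betw g {0, 1, 2::nat} X"
    using finite_same_card_bij[of "{0, 1, 2::nat}" X] finX by auto
  have sub3: "{0, 1, 2} \<subseteq> {..r}" using r by auto
  have "card ({..r} - {0, 1, 2}) = card (verts G - X)"
    using card_Diff_subset[OF _ sub3] card_Diff_subset[OF finX Xsub] cX G(2) by simp
  then obtain h where h: "bij_betw h ({..r} - {0, 1, 2}) (verts G - X)"
    using finite_same_card_bij[of "{..r} - {0, 1, 2}" "verts G - X"] fin by auto
  define f where "f i = (if i \<in> {0, 1, 2} then g i else h i)" for i
  have f1: "bij_betw f {0, 1, 2} X"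
    using g by (subst bij_betw_cong[of _ _ g]) (auto simp: f_def)
  have f2: "bij_betw f ({..r} - {0, 1, 2}) (verts G - X)"
    using h by (subst bij_betw_cong[of _ _ h]) (auto simp: f_def)
  have "bij_betw f ({0, 1, 2} \<union> ({..r} - {0, 1, 2})) (X \<union> (verts G - X))"
    by (rule bij_betw_combine[OF f1 f2]) auto
  then have f: "bij_betw f {..r} (verts G)"
    using sub3 Xsub by (simp only: Un_Diff_cancel Un_absorb1)
  have im: "f ` ({..r} - {i}) = verts G - {f i}" if "i \<in> {0, 1, 2}" for i
    using f that sub3 inj_on_image_set_diff[of f "{..r}" "{..r}" "{i}"]
    by (auto simp: bij_betw_def)
  have "edges G = (\<lambda>x. verts G - {x}) ` f ` {0, 1, 2}"
    using E f1 by (simp add: bij_betw_def)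
  also have "\<dots> = (\<lambda>e. f ` e) ` (\<lambda>i. {..r} - {i}) ` {0, 1, 2}"
    unfolding image_image using im by (intro image_cong) auto
  finally show ?thesis using f by (auto simp: r_triangle_def)
qed

lemma finite_turan_candidates:
  "finite {card (edges G) | G :: nat hypergraph.
            r_graph r G \<and> card (verts G) = n \<and> \<not> contains_copy G H}"
proof (rule finite_subset)
  show "{card (edges G) | G :: nat hypergraph.
            r_graph r G \<and> card (verts G) = n \<and> \<not> contains_copy G H} \<subseteq> {..2 ^ n}"
  proof clarsimp
    fix V :: "nat set" and E assume *: "r_graph r (V, E)"
    then have "E \<subseteq> Pow V" "finite V" by (auto simp: r_graph_def)
    then show "card E \<le> 2 ^ card V"
      by (metis card_Pow card_mono finite_Pow_iff)
  qed
qed simp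

lemma turan_candidates_nonempty:
  assumes "2 \<le> r" "edges H \<noteq> {}"
  shows "{card (edges G) | G :: nat hypergraph.
            r_graph r G \<and> card (verts G) = n \<and> \<not> contains_copy G H} \<noteq> {}"
proof -
  have "r_graph r ({..<n}, {}) \<and> card (verts ({..<n}, {})) = n \<and>
        \<not> contains_copy ({..<n}, {}) H"
    using assms by (auto simp: r_graph_def contains_copy_def)
  then show ?thesis by blast
qed

end

theory Submission
  imports Defs "HOL-Library.FuncSet"
begin

text \<open>
  Fix a tournament \<open>T\<close> on \<open>r\<close> vertices. In a host tournament take as edges the \<open>r\<close>-sets on which it is
  isomorphic to \<open>T\<close> up to switching, that is, up to reversing all arcs between a vertex set and its
  complement. A uniformly random host has expected edge density \<open>r! / (a * 2 ^ ((r - 1) choose 2))\<close>, where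
  \<open>a\<close> is the number of automorphisms of the switching class of \<open>T\<close>. Suitable \<open>T\<close> with
  \<open>(r, a) = (6, 5), (7, 9), (8, 1)\<close> have the property that no \<open>r + 1\<close> vertices span three edges; for this
  one lists the partial isomorphisms from \<open>T\<close> to \<open>T\<close> plus one vertex with unknown arcs and checks that any
  two of them with different images prescribe contradictory arcs at the new vertex.

  For \<open>r = 6\<close> the 12-vertex host given by the Paley tournament of order 11 and a dominating vertex has
  264 edges. Counting pairs of edges that share \<open>r - 1\<close> vertices shows that
  264 is optimal on 12 vertices, and equality forces all 5-sets to have degree 2, which is the design property.
\<close>

subsection \<open>Turan numbers and densities\<close>

lemma card_edges_le_turan_number:
  fixes G :: "nat hypergraph"
  assumes "r_graph r G" "card (verts G) = n" "\<not> contains_copy G H"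
  shows "card (edges G) \<le> turan_number r H n"
  unfolding turan_number_def
  by (rule Max_ge[OF finite_turan_candidates]) (use assms in blast)

lemma turan_number_attained:
  assumes "2 \<le> r" "edges H \<noteq> {}"
  obtains G :: "nat hypergraph" where "r_graph r G" "card (verts G) = n"
    "\<not> contains_copy G H" "card (edges G) = turan_number r H n"
  using Max_in[OF finite_turan_candidates turan_candidates_nonempty[OF assms, of n]]
  unfolding turan_number_def by auto

lemma contains_copy_mono:
  assumes "contains_copy G H" "verts G \<subseteq> verts G'" "edges G \<subseteq> edges G'"
  shows "contains_copy G' H"
proof -
  obtain f where "inj_on f (verts H)" "f ` verts H \<subseteq> verts G" "\<forall>e\<in>edges H. f ` e \<in> edges G"
    using assms(1) unfolding contains_copy_def by blast
  with assms(2,3) show ?thesis unfolding contains_copy_def by (intro exI[of _ f]) auto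
qed

text \<open>Averaging over vertex deletions of an extremal graph: each deletion leaves a graph
  without a copy of \<open>H\<close>, and an edge survives the deletion of every vertex outside
  it.\<close>

lemma turan_number_Suc:
  assumes "2 \<le> r" "edges H \<noteq> {}" "r \<le> n"
  shows "(Suc n - r) * turan_number r H (Suc n) \<le> Suc n * turan_number r H n"
proof -
  obtain G :: "nat hypergraph" where G: "r_graph r G" "card (verts G) = Suc n"
      "\<not> contains_copy G H" "card (edges G) = turan_number r H (Suc n)"
    using turan_number_attained[OF assms(1,2)] by blast
  obtain V E where VE: "G = (V, E)" by (cases G)
  have fV: "finite V" and E: "\<And>e. e \<in> E \<Longrightarrow> e \<subseteq> V \<and> card e = r"
    using G(1) VE by (auto simp: r_graph_def)
  have fE: "finite E" using fV E by (meson PowI finite_Pow_iff finite_subset subsetI)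
  have "(\<Sum>v\<in>V. card {e\<in>E. v \<notin> e}) = (Suc n - r) * card E"
  proof (rule sum_multicount[OF fV fE], rule ballI)
    fix e assume "e \<in> E"
    then have "e \<subseteq> V" "card e = r" using E by auto
    moreover have "{v\<in>V. v \<notin> e} = V - e" by blast
    ultimately show "card {v\<in>V. v \<notin> e} = Suc n - r"
      using G(2) VE fV by (simp add: card_Diff_subset finite_subset)
  qed
  moreover have "(\<Sum>v\<in>V. card {e\<in>E. v \<notin> e}) \<le> (\<Sum>v\<in>V. turan_number r H n)"
  proof (rule sum_mono)
    fix v assume v: "v \<in> V"
    let ?G = "(V - {v}, {e\<in>E. v \<notin> e})"
    have "r_graph r ?G" using G(1) VE by (auto simp: r_graph_def)
    moreover have "card (verts ?G) = n" using G(2) VE v by simp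
    moreover have "\<not> contains_copy ?G H"
      using G(3) contains_copy_mono[of ?G H G] VE by auto
    ultimately show "card {e\<in>E. v \<notin> e} \<le> turan_number r H n"
      using card_edges_le_turan_number by fastforce
  qed
  ultimately show ?thesis using G(2,4) VE by simp
qed

text \<open>Since \<open>turan_density\<close> is given by \<open>lim\<close>, a bound transfers
  only once convergence is known. By \<open>turan_number_Suc\<close> the edge densities decrease
  from \<open>n = r\<close> on, and they are nonnegative.\<close>

lemma turan_density_ge:
  assumes "2 \<le> r" "edges H \<noteq> {}"
    and lower: "\<And>n. r \<le> n \<Longrightarrow> c * real (n choose r) \<le> real (turan_number r H n)"
  shows "c \<le> turan_density r H"
proof -
  define f where "f n = real (turan_number r H n) / real (n choose r)" for n
  have dec: "f (Suc n) \<le> f n" if "r \<le> n" for n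
  proof -
    have pos: "0 < n choose r" "0 < Suc n choose r" using that by (simp_all add: zero_less_binomial)
    have ch: "(Suc n - r) * (Suc n choose r) = Suc n * (n choose r)"
      using that binomial_absorb_comp[of "Suc n" r] by simp
    have "(Suc n - r) * (turan_number r H (Suc n) * (n choose r))
        = (Suc n - r) * turan_number r H (Suc n) * (n choose r)" by simp
    also have "\<dots> \<le> Suc n * turan_number r H n * (n choose r)"
      using turan_number_Suc[OF assms(1,2) that] by (rule mult_le_mono1)
    also have "\<dots> = turan_number r H n * (Suc n * (n choose r))" by (simp only: mult_ac)
    also have "\<dots> = (Suc n - r) * (turan_number r H n * (Suc n choose r))"
      unfolding ch[symmetric] by (simp only: mult.assoc mult.left_commute)
    finally have "turan_number r H (Suc n) * (n choose r) \<le> turan_number r H n * (Suc n choose r)"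
      using that by (subst (asm) mult_le_cancel1) auto
    then have "real (turan_number r H (Suc n)) * real (n choose r)
        \<le> real (turan_number r H n) * real (Suc n choose r)"
      by (simp only: of_nat_mult[symmetric] of_nat_le_iff)
    then show ?thesis
      using pos unfolding f_def by (simp only: divide_le_eq pos_le_divide_eq frac_le_eq of_nat_0_less_iff)
        (simp add: field_simps)
  qed
  \<comment> \<open>The shift by \<open>r\<close> skips the \<open>n\<close> with
    \<open>n choose r = 0\<close>, where the quotient has the default value 0.\<close>
  have "decseq (\<lambda>n. f (n + r))"
    by (rule decseq_SucI) (use dec in auto)
  then obtain L where "(\<lambda>n. f (n + r)) \<longlonglongrightarrow> L"
    by (rule decseq_convergent[where B = 0]) (auto simp: f_def)
  then have L: "f \<longlonglongrightarrow> L" by (rule LIMSEQ_offset)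
  have "c \<le> f n" if "r \<le> n" for n
    using lower[OF that] that by (simp add: f_def pos_le_divide_eq zero_less_binomial)
  then have "c \<le> L" using L by (intro LIMSEQ_le_const) auto
  also have "L = turan_density r H"
    using limI[OF L] unfolding turan_density_def f_def by simp
  finally show ?thesis .
qed

subsection \<open>Switching classes of tournaments\<close>

definition tournament_on :: "'a set \<Rightarrow> ('a \<Rightarrow> 'a \<Rightarrow> bool) \<Rightarrow> bool" where
  "tournament_on V S \<longleftrightarrow> (\<forall>x\<in>V. \<forall>y\<in>V. x \<noteq> y \<longrightarrow> S y x = (\<not> S x y))"

lemma tournament_onD:
  "tournament_on V S \<Longrightarrow> x \<in> V \<Longrightarrow> y \<in> V \<Longrightarrow> x \<noteq> y \<Longrightarrow> S y x = (\<not> S x y)"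
  unfolding tournament_on_def by blast

text \<open>The parity of the number of arcs pointing forward along the closed walk \<open>x, y, z, x\<close>;
  reversing all arcs at a vertex does not change it.\<close>

definition cyc :: "('a \<Rightarrow> 'a \<Rightarrow> bool) \<Rightarrow> 'a \<Rightarrow> 'a \<Rightarrow> 'a \<Rightarrow> bool" where
  "cyc S x y z = ((S x y = S y z) = S z x)"

text \<open>Two tournaments have the same \<open>cyc\<close> on all triples exactly if they differ
  by switching, so these are the embeddings of \<open>T\<close> up to switching. Extensionality
  makes the maps countable.\<close>

definition copies :: "(nat \<Rightarrow> nat \<Rightarrow> bool) \<Rightarrow> nat \<Rightarrow> 'a set \<Rightarrow> ('a \<Rightarrow> 'a \<Rightarrow> bool) \<Rightarrow> (nat \<Rightarrow> 'a) set" where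
  "copies T r V S = {f \<in> {..<r} \<rightarrow>\<^sub>E V. inj_on f {..<r} \<and>
     (\<forall>i j k. i < j \<longrightarrow> j < k \<longrightarrow> k < r \<longrightarrow> cyc S (f i) (f j) (f k) = cyc T i j k)}"

definition copy_graph :: "(nat \<Rightarrow> nat \<Rightarrow> bool) \<Rightarrow> nat \<Rightarrow> 'a set \<Rightarrow> ('a \<Rightarrow> 'a \<Rightarrow> bool) \<Rightarrow> 'a hypergraph" where
  "copy_graph T r V S = (V, (\<lambda>f. f ` {..<r}) ` copies T r V S)"

text \<open>For tournaments \<open>cyc\<close> is invariant under rotating its arguments, and a
  transposition negates it because all three arcs are reversed. Both sides therefore change alike
  when the triple is sorted.\<close>

lemma cyc_eq_of_sorted:
  fixes r :: nat
  assumes T: "tournament_on {..<r} T" and S: "tournament_on (f ` {..<r}) S"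
    and inj: "inj_on f {..<r}"
    and sorted: "\<And>i j k. i < j \<Longrightarrow> j < k \<Longrightarrow> k < r \<Longrightarrow> cyc S (f i) (f j) (f k) = cyc T i j k"
    and ijk: "i < r" "j < r" "k < r" "i \<noteq> j" "j \<noteq> k" "i \<noteq> k"
  shows "cyc S (f i) (f j) (f k) = cyc T i j k"
proof -
  have T': "T y x = (\<not> T x y)" if "x < r" "y < r" "x \<noteq> y" for x y
    using that by (intro tournament_onD[OF T]) auto
  have S': "S (f y) (f x) = (\<not> S (f x) (f y))" if "x < r" "y < r" "x \<noteq> y" for x y
    using that inj_onD[OF inj, of x y] by (intro tournament_onD[OF S]) auto
  have t: "T j i = (\<not> T i j)" "T k j = (\<not> T j k)" "T k i = (\<not> T i k)"
       "S (f j) (f i) = (\<not> S (f i) (f j))" "S (f k) (f j) = (\<not> S (f j) (f k))"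
       "S (f k) (f i) = (\<not> S (f i) (f k))"
    by (intro T' S' ijk)+
  consider "i < j" "j < k" | "i < k" "k < j" | "j < i" "i < k" | "j < k" "k < i"
    | "k < i" "i < j" | "k < j" "j < i" using ijk(4-6) unfolding nat_neq_iff by blast
  then show ?thesis
  proof cases
    case 1 then show ?thesis using sorted ijk by blast
  next
    case 2 then show ?thesis using sorted[of i k j] ijk t unfolding cyc_def by argo
  next
    case 3 then show ?thesis using sorted[of j i k] ijk t unfolding cyc_def by argo
  next
    case 4 then show ?thesis using sorted[of j k i] ijk t unfolding cyc_def by argo
  next
    case 5 then show ?thesis using sorted[of k i j] ijk t unfolding cyc_def by argo
  next
    case 6 then show ?thesis using sorted[of k j i] ijk t unfolding cyc_def by argo
  qed
qed

lemma copiesD: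
  assumes "f \<in> copies T r V S"
  shows "inj_on f {..<r}" "f ` {..<r} \<subseteq> V" "f \<in> extensional {..<r}"
    "\<And>i j k. i < j \<Longrightarrow> j < k \<Longrightarrow> k < r \<Longrightarrow> cyc S (f i) (f j) (f k) = cyc T i j k"
  using assms unfolding copies_def by (auto simp: PiE_def)

lemma cyc_copies:
  assumes "tournament_on {..<r} T" "tournament_on V S" "f \<in> copies T r V S"
    "i < r" "j < r" "k < r" "i \<noteq> j" "j \<noteq> k" "i \<noteq> k"
  shows "cyc S (f i) (f j) (f k) = cyc T i j k"
proof (rule cyc_eq_of_sorted[OF assms(1)])
  show "tournament_on (f ` {..<r}) S"
    using assms(2) copiesD(2)[OF assms(3)] unfolding tournament_on_def by blast
qed (use assms copiesD[OF assms(3)] in auto)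

lemma finite_copies: "finite V \<Longrightarrow> finite (copies T r V S)"
  by (rule finite_subset[of _ "{..<r} \<rightarrow>\<^sub>E V"]) (auto simp: copies_def intro: finite_PiE)

lemma r_graph_copy_graph:
  assumes "2 \<le> r" "finite V"
  shows "r_graph r (copy_graph T r V S)"
  using assms copiesD(1,2) by (fastforce simp: r_graph_def copy_graph_def card_image)

text \<open>Two copies with the same vertex set differ by an automorphism of the template.\<close>

lemma card_copies_le:
  assumes T: "tournament_on {..<r} T" and S: "tournament_on V S" and "finite V"
    and aut: "card (copies T r {..<r} T) \<le> a"
  shows "card (copies T r V S) \<le> a * card (edges (copy_graph T r V S))"
proof -
  let ?C = "copies T r V S" and ?E = "(\<lambda>f. f ` {..<r}) ` copies T r V S"
  have fC: "finite ?C" using \<open>finite V\<close> by (rule finite_copies)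
  have fibre: "card {f \<in> ?C. f ` {..<r} = A} \<le> a" if A_in: "A \<in> ?E" for A
  proof -
    obtain h where h: "h \<in> ?C" and A: "A = h ` {..<r}" using A_in by blast
    note hi = copiesD(1)[OF h]
    \<comment> \<open>The fixed copy \<open>h\<close> onto \<open>A\<close> serves as a coordinate
      system: \<open>\<phi> f\<close> is the permutation of \<open>{..<r}\<close> that turns
      \<open>h\<close> into \<open>f\<close>.\<close>
    define \<phi> where "\<phi> f = restrict (inv_into {..<r} h \<circ> f) {..<r}" for f
    have \<phi>: "\<phi> f i < r \<and> h (\<phi> f i) = f i" if "f \<in> ?C" "f ` {..<r} = A" "i < r" for f i
    proof -
      have "f i \<in> h ` {..<r}" using that A by blast
      then show ?thesis
        using that inv_into_into[of "f i" h "{..<r}"] f_inv_into_f[of "f i" h "{..<r}"]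
        by (auto simp: \<phi>_def)
    qed
    have "card {f \<in> ?C. f ` {..<r} = A} \<le> card (copies T r {..<r} T)"
    proof (rule card_inj_on_le[of \<phi>])
      show "inj_on \<phi> {f \<in> ?C. f ` {..<r} = A}"
      proof (rule inj_onI)
        fix f g assume fg: "f \<in> {f \<in> ?C. f ` {..<r} = A}" "g \<in> {f \<in> ?C. f ` {..<r} = A}" "\<phi> f = \<phi> g"
        show "f = g"
        proof (rule extensionalityI[of _ "{..<r}"])
          show "f i = g i" if "i \<in> {..<r}" for i
            using \<phi>[of f i] \<phi>[of g i] fg that by force
        qed (use fg in \<open>auto intro: copiesD(3)\<close>)
      qed
      show "\<phi> ` {f \<in> ?C. f ` {..<r} = A} \<subseteq> copies T r {..<r} T"
      proof clarify
        fix f assume f: "f \<in> ?C" "A = f ` {..<r}"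
        note p = \<phi>[OF f(1) f(2)[symmetric]]
        have inj: "inj_on (\<phi> f) {..<r}"
          
        proof (rule inj_onI)
          fix i j assume ij: "i \<in> {..<r}" "j \<in> {..<r}" "\<phi> f i = \<phi> f j"
          then have "f i = f j" using p[of i] p[of j] by simp
          then show "i = j" using inj_onD[OF copiesD(1)[OF f(1)]] ij by blast
        qed
        have "cyc T (\<phi> f i) (\<phi> f j) (\<phi> f k) = cyc T i j k" if "i < j" "j < k" "k < r" for i j k
        proof -
          have lt: "i < r" "j < r" using that by auto
          have "\<phi> f i \<noteq> \<phi> f j" "\<phi> f j \<noteq> \<phi> f k" "\<phi> f i \<noteq> \<phi> f k"
            using that lt inj_onD[OF inj] by (metis lessThan_iff nat_neq_iff less_trans)+
          then have "cyc T (\<phi> f i) (\<phi> f j) (\<phi> f k)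
              = cyc S (h (\<phi> f i)) (h (\<phi> f j)) (h (\<phi> f k))"
            using cyc_copies[OF T S h, of "\<phi> f i" "\<phi> f j" "\<phi> f k"] p[OF lt(1)] p[OF lt(2)] p[OF that(3)]
            by argo
          then show ?thesis
            using p[OF lt(1)] p[OF lt(2)] p[OF that(3)] copiesD(4)[OF f(1) that] by argo
        qed
        then show "\<phi> f \<in> copies T r {..<r} T"
          using inj p unfolding copies_def by (auto simp: \<phi>_def)
      qed
    qed (simp add: finite_copies)
    then show ?thesis using aut by simp
  qed
  have "card ?C = card (\<Union>A\<in>?E. {f \<in> ?C. f ` {..<r} = A})"
    by (rule arg_cong[of _ _ card]) auto
  also have "\<dots> \<le> (\<Sum>A\<in>?E. card {f \<in> ?C. f ` {..<r} = A})"
    by (rule card_UN_le) (use fC in simp)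
  also have "\<dots> \<le> (\<Sum>A\<in>?E. a)" by (rule sum_mono) (rule fibre)
  finally show ?thesis by (simp add: copy_graph_def mult.commute)
qed

subsection \<open>Averaging over all tournaments\<close>

definition pairs :: "nat \<Rightarrow> nat set set" where
  "pairs n = {e. e \<subseteq> {..<n} \<and> card e = 2}"

text \<open>The tournaments on \<open>{..<n}\<close> correspond to the subsets \<open>X\<close> of \<open>pairs n\<close>.\<close>

definition orient :: "nat set set \<Rightarrow> nat \<Rightarrow> nat \<Rightarrow> bool" where
  "orient X x y = ((x < y) = ({x, y} \<in> X))"

lemma tournament_orient: "tournament_on V (orient X)"
  by (auto simp: tournament_on_def orient_def insert_commute)

lemma finite_pairs: "finite (pairs n)"
  by (rule finite_subset[of _ "Pow {..<n}"]) (auto simp: pairs_def)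

lemma card_inj_PiE:
  "card {f \<in> {..<r} \<rightarrow>\<^sub>E {..<n::nat}. inj_on f {..<r}} = (n choose r) * fact r"
proof -
  have "card {f \<in> {..<r} \<rightarrow>\<^sub>E {..<n}. inj_on f {..<r}} = (\<Prod>i<r. n - i)"
    using card_inj_on_subset_funcset[of "{..<r}" "{..<n}" "{..<r}"] by (simp add: atLeast0LessThan)
  also have "\<dots> = (n choose r) * fact r"
  proof (induction r)
    case (Suc r)
    have "(n choose Suc r) * fact (Suc r) = (Suc r * (n choose Suc r)) * fact r"
      by (simp only: fact_Suc of_nat_id mult.assoc mult.left_commute)
    also have "Suc r * (n choose Suc r) = (n - r) * (n choose r)"
      by (simp only: binomial_absorb_comp binomial_absorption)
    finally show ?case using Suc by (simp add: mult_ac)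
  qed simp
  finally show ?thesis .
qed

text \<open>The map \<open>\<phi>\<close> below reorients only the pairs \<open>D\<close> inside \<open>f ` {1..<r}\<close>, in the unique way that makes \<open>f\<close> a copy,
  so \<open>X\<close> is determined by \<open>\<phi> X\<close> and \<open>X \<inter> D\<close>.\<close>

lemma card_orient_copies_ge:
  assumes T: "tournament_on {..<r} T" and f: "f \<in> {..<r} \<rightarrow>\<^sub>E {..<n}" "inj_on f {..<r}" and "0 < r"
  shows "2 ^ card (pairs n) \<le> 2 ^ ((r - 1) choose 2) * card {X \<in> Pow (pairs n). f \<in> copies T r {..<n} (orient X)}"
proof -
  let ?G = "{X \<in> Pow (pairs n). f \<in> copies T r {..<n} (orient X)}"
  define W where "W = f ` {1..<r}"
  define D where "D = {e. e \<subseteq> W \<and> card e = 2}"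
  define g where "g = inv_into {..<r} f"
  have g: "g (f i) = i" if "i < r" for i using that f(2) by (simp add: g_def)
  \<comment> \<open>All arcs at \<open>f 0\<close> keep their host orientation.
    \<open>sw X j\<close> fails exactly for the vertices at which \<open>T\<close> must be switched
    to agree with them.\<close>
  define sw where "sw X j \<longleftrightarrow> j = 0 \<or> orient X (f 0) (f j) = T 0 j" for X j
  \<comment> \<open>On \<open>W\<close> this is \<open>T\<close> switched at the vertices where
    \<open>sw\<close> fails: an arc is reversed when exactly one of its ends is switched.\<close>
  define S where "S X x y = (if x \<in> W \<and> y \<in> W then T (g x) (g y) = (sw X (g x) = sw X (g y))
    else orient X x y)" for X x y
  define \<phi> where "\<phi> X = {e \<in> pairs n. \<exists>x y. e = {x, y} \<and> x < y \<and> S X x y}" for X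
  have inW: "f i \<in> W \<longleftrightarrow> 0 < i" if "i < r" for i
  proof -
    have "f i \<in> W \<longleftrightarrow> i \<in> {1..<r}"
      unfolding W_def by (rule inj_on_image_mem_iff[OF f(2)]) (use that in auto)
    then show ?thesis using that by auto
  qed
  have gW: "g x < r" "f (g x) = x" if "x \<in> W" for x
    using that g unfolding W_def by auto
  have S_tour: "S X y x = (\<not> S X x y)" if "x \<noteq> y" for X x y
  proof (cases "x \<in> W \<and> y \<in> W")
    case True
    then have "g x \<noteq> g y" using gW that by metis
    then have "T (g y) (g x) = (\<not> T (g x) (g y))"
      using True gW(1) by (intro tournament_onD[OF T]) auto
    then show ?thesis using True unfolding S_def by auto
  next
    case False
    then show ?thesis
      using tournament_onD[OF tournament_orient UNIV_I UNIV_I that] unfolding S_def by auto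
  qed
  have mem: "{x, y} \<in> \<phi> X \<longleftrightarrow> S X x y" if "x < y" "y < n" for X x y
  proof -
    have "{x, y} \<in> pairs n" using that by (simp add: pairs_def)
    then have "{x, y} \<in> \<phi> X \<longleftrightarrow> (\<exists>u v. {x, y} = {u, v} \<and> u < v \<and> S X u v)"
      unfolding \<phi>_def by simp
    then show ?thesis using that unfolding doubleton_eq_iff by (metis less_asym)
  qed
  have orient_\<phi>: "orient (\<phi> X) x y = S X x y" if "x < n" "y < n" "x \<noteq> y" for X x y
  proof (cases "x < y")
    case True
    then show ?thesis using mem[of x y] that by (simp add: orient_def)
  next
    case False
    then have "y < x" using that by simp
    then show ?thesis using mem[of y x] that S_tour[of x y] by (simp add: orient_def insert_commute)
  qed
  have fn: "f i < n" if "i < r" for i using PiE_mem[OF f(1)] that by blast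
  have S_f: "S X (f i) (f j) = (T i j = (sw X i = sw X j))" if "i < r" "j < r" "i \<noteq> j" for X i j
  proof (cases "i = 0 \<or> j = 0")
    case False
    then show ?thesis using that inW g by (simp add: S_def)
  next
    case True
    have "f i \<noteq> f j" using that inj_onD[OF f(2), of i j] by auto
    then have "orient X (f j) (f i) = (\<not> orient X (f i) (f j))"
      by (rule tournament_onD[OF tournament_orient UNIV_I UNIV_I])
    moreover have "T j i = (\<not> T i j)" using that by (intro tournament_onD[OF T]) auto
    ultimately show ?thesis using True that inW by (auto simp: S_def sw_def)
  qed
  have good: "\<phi> X \<in> ?G" for X
  proof -
    \<comment> \<open>Each vertex of the closed walk is an end of two of its arcs, so the switchings
      cancel.\<close>
    have "cyc (orient (\<phi> X)) (f i) (f j) (f k) = cyc T i j k" if "i < j" "j < k" "k < r" for i j k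
    proof -
      have d: "i < r" "j < r" "k < r" "i \<noteq> j" "j \<noteq> k" "k \<noteq> i" using that by auto
      then have "f i \<noteq> f j" "f j \<noteq> f k" "f k \<noteq> f i" using inj_onD[OF f(2)] by (metis lessThan_iff)+
      then show ?thesis using d by (auto simp: cyc_def orient_\<phi> fn S_f)
    qed
    then show ?thesis using f by (auto simp: copies_def \<phi>_def)
  qed
  have outside: "\<phi> X - D = X - D" if "X \<subseteq> pairs n" for X
  proof -
    have "e \<in> \<phi> X \<longleftrightarrow> e \<in> X" if e: "e \<in> pairs n" "e \<notin> D" for e
    proof -
      obtain v w where "e = {v, w}" "v \<noteq> w"
        using e(1) by (auto simp: pairs_def card_2_iff)
      then obtain x y where xy: "e = {x, y}" "x < y"
        by (cases "v < w") (auto simp: insert_commute nat_neq_iff)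
      then have "y < n" using e(1) by (auto simp: pairs_def)
      moreover have "\<not> (x \<in> W \<and> y \<in> W)" using e(2) xy by (auto simp: D_def)
      ultimately show ?thesis using xy mem[of x y X] by (auto simp: S_def orient_def)
    qed
    moreover have "\<phi> X \<subseteq> pairs n" by (auto simp: \<phi>_def)
    ultimately show ?thesis using that by blast
  qed
  have finW: "finite W" by (simp add: W_def)
  have "inj_on f {1..<r}" by (rule inj_on_subset[OF f(2)]) auto
  then have "card W = r - 1" unfolding W_def by (simp add: card_image)
  then have cD: "card D = (r - 1) choose 2"
    unfolding D_def using n_subsets[OF finW, of 2] by simp
  have finD: "finite D" unfolding D_def by (rule finite_subset[of _ "Pow W"]) (use finW in auto)
  have finG: "finite ?G" using finite_pairs by simp
  have "2 ^ card (pairs n) = card (Pow (pairs n))" by (simp add: card_Pow finite_pairs)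
  also have "\<dots> \<le> card (Pow D \<times> ?G)"
  proof (rule card_inj_on_le[of "\<lambda>X. (X \<inter> D, \<phi> X)"])
    show "inj_on (\<lambda>X. (X \<inter> D, \<phi> X)) (Pow (pairs n))"
    proof (rule inj_onI)
      fix X Y assume XY: "X \<in> Pow (pairs n)" "Y \<in> Pow (pairs n)" "(X \<inter> D, \<phi> X) = (Y \<inter> D, \<phi> Y)"
      then have "X - D = Y - D" using outside[of X] outside[of Y] by auto
      moreover have "X \<inter> D = Y \<inter> D" using XY(3) by simp
      ultimately show "X = Y" by blast
    qed
    show "(\<lambda>X. (X \<inter> D, \<phi> X)) ` Pow (pairs n) \<subseteq> Pow D \<times> ?G" using good by auto
  qed (use finD finG in simp)
  also have "\<dots> = 2 ^ ((r - 1) choose 2) * card ?G"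
    by (simp add: card_cartesian_product card_Pow finD cD)
  finally show ?thesis .
qed

text \<open>Double counting of the pairs of a tournament \<open>X\<close> and an injection
  \<open>f\<close> that is a copy in it: each \<open>f\<close> works for at least one in
  \<open>2 ^ ((r - 1) choose 2)\<close> of all \<open>X\<close>, and some \<open>X\<close> reaches
  the average.\<close>

lemma exists_many_copies:
  assumes T: "tournament_on {..<r} T" and "0 < r"
  shows "\<exists>X. (n choose r) * fact r \<le> 2 ^ ((r - 1) choose 2) * card (copies T r {..<n} (orient X))"
proof (rule ccontr)
  let ?I = "{f \<in> {..<r} \<rightarrow>\<^sub>E {..<n}. inj_on f {..<r}}" and ?P = "Pow (pairs n)"
  let ?b = "2 ^ ((r - 1) choose 2) :: nat"
  assume "\<not> ?thesis"
  then have less: "?b * card (copies T r {..<n} (orient X)) < (n choose r) * fact r" for X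
    by (simp add: not_le)
  have fI: "finite ?I" by (simp add: finite_PiE)
  have "(\<Sum>X\<in>?P. card {f\<in>?I. f \<in> copies T r {..<n} (orient X)})
      = (\<Sum>f\<in>?I. card {X\<in>?P. f \<in> copies T r {..<n} (orient X)})"
    by (rule sum_multicount_gen) (use fI finite_pairs in auto)
  moreover have "{f\<in>?I. f \<in> copies T r {..<n} (orient X)} = copies T r {..<n} (orient X)" for X
    by (auto simp: copies_def)
  ultimately have sums: "(\<Sum>X\<in>?P. ?b * card (copies T r {..<n} (orient X)))
      = (\<Sum>f\<in>?I. ?b * card {X\<in>?P. f \<in> copies T r {..<n} (orient X)})"
    by (simp add: sum_distrib_left[symmetric])
  have "(\<Sum>f\<in>?I. 2 ^ card (pairs n)) \<le> (\<Sum>f\<in>?I. ?b * card {X\<in>?P. f \<in> copies T r {..<n} (orient X)})"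
    by (rule sum_mono) (use card_orient_copies_ge[OF T] assms(2) in auto)
  also have "\<dots> < (\<Sum>X\<in>?P. (n choose r) * fact r)"
    unfolding sums[symmetric] by (rule sum_strict_mono) (use less finite_pairs in auto)
  also have "\<dots> = 2 ^ card (pairs n) * ((n choose r) * fact r)"
    by (simp add: card_Pow finite_pairs)
  finally show False by (simp add: card_inj_PiE)
qed

subsection \<open>Searching for copies\<close>

text \<open>The functions of this section are evaluated by rewriting. They are written without abstractions,
  because the simplifier would also work on the bodies of abstractions, for symbolic arguments.\<close>

fun fresh :: "'v \<Rightarrow> (nat \<times> 'v) list \<Rightarrow> bool" where
  "fresh x [] = True"
| "fresh x ((j, y) # q) = (if x = y then False else fresh x q)"

text \<open>\<open>K x y z m j k\<close> judges whether \<open>x\<close>, \<open>y\<close>,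
  \<open>z\<close> may be the values at the indices \<open>m\<close>, \<open>j\<close>,
  \<open>k\<close>. A search fills the indices downwards, so only increasing triples are
  tested.\<close>

fun fits_pair :: "('v \<Rightarrow> 'v \<Rightarrow> 'v \<Rightarrow> nat \<Rightarrow> nat \<Rightarrow> nat \<Rightarrow> bool) \<Rightarrow> nat \<Rightarrow> 'v \<Rightarrow> nat \<Rightarrow> 'v \<Rightarrow> (nat \<times> 'v) list \<Rightarrow> bool" where
  "fits_pair K m x j y [] = True"
| "fits_pair K m x j y ((k, z) # q) = (if K x y z m j k then fits_pair K m x j y q else False)"

fun fits :: "('v \<Rightarrow> 'v \<Rightarrow> 'v \<Rightarrow> nat \<Rightarrow> nat \<Rightarrow> nat \<Rightarrow> bool) \<Rightarrow> nat \<Rightarrow> 'v \<Rightarrow> (nat \<times> 'v) list \<Rightarrow> bool" where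
  "fits K m x [] = True"
| "fits K m x ((j, y) # q) = (if fits_pair K m x j y q then fits K m x q else False)"

text \<open>Extends the partial map \<open>q\<close>, given on \<open>{m..<r}\<close>, to all of \<open>{..<r}\<close>;
  \<open>cs\<close> holds the untried values for \<open>m - 1\<close>.\<close>

fun search :: "('v \<Rightarrow> 'v \<Rightarrow> 'v \<Rightarrow> nat \<Rightarrow> nat \<Rightarrow> nat \<Rightarrow> bool) \<Rightarrow> 'v list \<Rightarrow> 'v list \<Rightarrow> nat \<Rightarrow> (nat \<times> 'v) list \<Rightarrow> (nat \<times> 'v) list list" where
  "search K vs cs 0 q = [q]"
| "search K vs [] (Suc m) q = []"
| "search K vs (x # cs) (Suc m) q =
    (if fresh x q
     then if fits K m x q then search K vs vs m ((m, x) # q) @ search K vs cs (Suc m) q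
       else search K vs cs (Suc m) q
     else search K vs cs (Suc m) q)"

lemma fresh_iff: "fresh x q \<longleftrightarrow> x \<notin> snd ` set q"
  by (induction x q rule: fresh.induct) auto

lemma fits_pair_iff: "fits_pair K m x j y q \<longleftrightarrow> (\<forall>(k, z)\<in>set q. K x y z m j k)"
  by (induction q) (auto split: if_splits)

lemma set_search_Suc:
  "set (search K vs cs (Suc m) q) =
    (\<Union>x\<in>{x \<in> set cs. fresh x q \<and> fits K m x q}. set (search K vs vs m ((m, x) # q)))"
  by (induction cs) auto

definition graph_list :: "nat \<Rightarrow> nat \<Rightarrow> (nat \<Rightarrow> 'v) \<Rightarrow> (nat \<times> 'v) list" where
  "graph_list m r f = map (\<lambda>i. (i, f i)) [m..<r]"

lemma graph_list_Cons: "m < r \<Longrightarrow> graph_list m r f = (m, f m) # graph_list (Suc m) r f"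
  by (simp add: graph_list_def upt_conv_Cons)

lemma graph_list_Nil: "r \<le> m \<Longrightarrow> graph_list m r f = []"
  by (simp add: graph_list_def)

lemma set_graph_list: "set (graph_list m r f) = (\<lambda>i. (i, f i)) ` {m..<r}"
  by (simp add: graph_list_def)

lemma snd_set_graph_list: "snd ` set (graph_list 0 r f) = f ` {..<r}"
  by (simp add: set_graph_list image_image atLeast0LessThan)

lemma fits_graph_list:
  "fits K m x (graph_list s r f) \<longleftrightarrow> (\<forall>j k. s \<le> j \<longrightarrow> j < k \<longrightarrow> k < r \<longrightarrow> K x (f j) (f k) m j k)"
proof (induction "r - s" arbitrary: s)
  case 0
  then show ?case by (auto simp: graph_list_Nil)
next
  case (Suc d)
  then have s: "s < r" "d = r - Suc s" by auto
  have "fits K m x (graph_list s r f) \<longleftrightarrow>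
      (\<forall>k\<in>{Suc s..<r}. K x (f s) (f k) m s k) \<and> fits K m x (graph_list (Suc s) r f)"
    using s by (auto simp: graph_list_Cons fits_pair_iff set_graph_list)
  also have "\<dots> \<longleftrightarrow> (\<forall>j k. s \<le> j \<longrightarrow> j < k \<longrightarrow> k < r \<longrightarrow> K x (f j) (f k) m j k)"
    unfolding Suc.hyps(1)[OF s(2)] by (metis Suc_le_eq atLeastLessThan_iff le_neq_implies_less nat_less_le order.refl)
  finally show ?case .
qed

text \<open>This direction supports universal claims drawn from a search: choosing the values of
  \<open>f\<close> one after another never fails a test.\<close>

lemma search_complete:
  assumes "inj_on f {..<r}" "f ` {..<r} \<subseteq> set vs"
    and K: "\<And>i j k. i < j \<Longrightarrow> j < k \<Longrightarrow> k < r \<Longrightarrow> K (f i) (f j) (f k) i j k"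
    and "m \<le> r"
  shows "graph_list 0 r f \<in> set (search K vs vs m (graph_list m r f))"
  using \<open>m \<le> r\<close>
proof (induction m)
  case (Suc m)
  have "fresh (f m) (graph_list (Suc m) r f)"
    using Suc.prems inj_onD[OF assms(1), of m] by (force simp: fresh_iff set_graph_list)
  moreover have "fits K m (f m) (graph_list (Suc m) r f)"
    unfolding fits_graph_list using K by (auto simp: Suc_le_eq)
  moreover have "f m \<in> set vs" using assms(2) Suc.prems by auto
  moreover have "graph_list 0 r f \<in> set (search K vs vs m ((m, f m) # graph_list (Suc m) r f))"
    using Suc by (simp add: graph_list_Cons)
  ultimately show ?case unfolding set_search_Suc by blast
qed simp

text \<open>This direction supports lower bounds on the number of maps. The induction extends
  \<open>f\<close> by the value chosen at \<open>m\<close>.\<close>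

lemma search_sound:
  assumes "q \<in> set (search K vs vs m (graph_list m r f))" "m \<le> r"
    and "inj_on f {m..<r}" "f ` {m..<r} \<subseteq> set vs"
    and "\<And>i j k. m \<le> i \<Longrightarrow> i < j \<Longrightarrow> j < k \<Longrightarrow> k < r \<Longrightarrow> K (f i) (f j) (f k) i j k"
  shows "\<exists>g. q = graph_list 0 r g \<and> inj_on g {..<r} \<and> g ` {..<r} \<subseteq> set vs \<and>
    (\<forall>i j k. i < j \<longrightarrow> j < k \<longrightarrow> k < r \<longrightarrow> K (g i) (g j) (g k) i j k)"
  using assms
proof (induction m arbitrary: f)
  case 0
  then show ?case by (intro exI[of _ f]) (auto simp: atLeast0LessThan)
next
  case (Suc m)
  from Suc.prems(1) obtain x where x: "x \<in> set vs" "x \<notin> f ` {Suc m..<r}"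
      "fits K m x (graph_list (Suc m) r f)" "q \<in> set (search K vs vs m ((m, x) # graph_list (Suc m) r f))"
    unfolding set_search_Suc by (force simp: fresh_iff set_graph_list)
  let ?f = "f(m := x)"
  have gl: "graph_list m r ?f = (m, x) # graph_list (Suc m) r f"
    using Suc.prems(2) by (simp add: graph_list_Cons) (simp add: graph_list_def)
  have iv: "{m..<r} = insert m {Suc m..<r}" using Suc.prems(2) by auto
  show ?case
  proof (rule Suc.IH)
    show "q \<in> set (search K vs vs m (graph_list m r ?f))" using x(4) by (simp add: gl)
    show "inj_on ?f {m..<r}" unfolding iv using Suc.prems(3) x(2) by (auto simp: inj_on_def)
    show "?f ` {m..<r} \<subseteq> set vs" unfolding iv using Suc.prems(4) x(1) by auto
    show "K (?f i) (?f j) (?f k) i j k" if "m \<le> i" "i < j" "j < k" "k < r" for i j k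
      using that x(3) Suc.prems(5)[of i j k] unfolding fits_graph_list by (cases "i = m") auto
  qed (use Suc.prems(2) in simp)
qed

lemma search_suffix: "p \<in> set (search K vs cs m q) \<Longrightarrow> \<exists>p'. p = p' @ q \<and> length p' = m"
proof (induction m arbitrary: cs q)
  case (Suc m)
  then obtain x where "p \<in> set (search K vs vs m ((m, x) # q))" unfolding set_search_Suc by blast
  then obtain p' where "p = p' @ (m, x) # q" "length p' = m" using Suc.IH by blast
  then show ?case by (intro exI[of _ "p' @ [(m, x)]"]) simp
qed simp

text \<open>Different values tried at the same index stay visible in the results, at the same
  position by \<open>search_suffix\<close>. Hence the length of a result list counts maps.\<close>

lemma distinct_search:
  assumes "distinct vs" "distinct cs"
  shows "distinct (search K vs cs m q)"
  using assms
proof (induction K vs cs m q rule: search.induct)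
  case (3 K vs x cs m q)
  have "False" if p: "p \<in> set (search K vs vs m ((m, x) # q))" "p \<in> set (search K vs cs (Suc m) q)" for p
  proof -
    obtain y where y: "y \<in> set cs" "p \<in> set (search K vs vs m ((m, y) # q))"
      using p(2) unfolding set_search_Suc by blast
    then show False using search_suffix[OF p(1)] search_suffix[OF y(2)] "3.prems" by auto
  qed
  then show ?case using "3" by auto
qed auto

text \<open>In \<open>{..r}\<close> the arcs at the vertex \<open>r\<close> are unknown; the others are those of the template.\<close>

definition wild :: "(nat \<Rightarrow> nat \<Rightarrow> bool) \<Rightarrow> nat \<Rightarrow> nat \<Rightarrow> nat \<Rightarrow> nat \<Rightarrow> nat \<Rightarrow> nat \<Rightarrow> nat \<Rightarrow> bool" where
  "wild T r x y z i j k = (if x = r then True else if y = r then True else if z = r then True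
     else cyc T x y z = cyc T i j k)"

section \<open>Comparing two partial isomorphisms\<close>

fun index :: "'v \<Rightarrow> (nat \<times> 'v) list \<Rightarrow> nat option" where
  "index x [] = None"
| "index x ((j, y) # q) = (if x = y then Some j else index x q)"

fun inverse_list :: "'v list \<Rightarrow> (nat \<times> 'v) list \<Rightarrow> nat option list" where
  "inverse_list [] q = []"
| "inverse_list (x # vs) q = index x q # inverse_list vs q"

text \<open>Inverse lists allow two maps to be compared vertex by vertex; here they give the pairs
  of indices with a common image.\<close>

fun join :: "nat option list \<Rightarrow> nat option list \<Rightarrow> (nat \<times> nat) list" where
  "join (Some i # p) (Some j # p') = (i, j) # join p p'"
| "join (u # p) (v # p') = join p p'"
| "join p p' = []"

text \<open>For inverse lists this is inclusion of the images among the listed vertices. Two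
  injections of \<open>{..<r}\<close> have images of equal size, so there inclusion means
  equality.\<close>

fun covered :: "nat option list \<Rightarrow> nat option list \<Rightarrow> bool" where
  "covered (Some i # p) (None # p') = False"
| "covered (u # p) (v # p') = covered p p'"
| "covered p p' = True"

fun agree3 :: "(nat \<Rightarrow> nat \<Rightarrow> bool) \<Rightarrow> nat \<Rightarrow> nat \<Rightarrow> nat \<Rightarrow> nat \<Rightarrow> (nat \<times> nat) list \<Rightarrow> bool" where
  "agree3 T i i' j j' [] = True"
| "agree3 T i i' j j' ((k, k') # J) = (if cyc T i j k = cyc T i' j' k' then agree3 T i i' j j' J else False)"

fun agree2 :: "(nat \<Rightarrow> nat \<Rightarrow> bool) \<Rightarrow> nat \<Rightarrow> nat \<Rightarrow> (nat \<times> nat) list \<Rightarrow> bool" where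
  "agree2 T i i' [] = True"
| "agree2 T i i' ((j, j') # J) = (if agree3 T i i' j j' J then agree2 T i i' J else False)"

text \<open>A failure exhibits three common vertices on which the two maps prescribe different
  \<open>cyc\<close> values, so no tournament admits both as copies.\<close>

fun agree :: "(nat \<Rightarrow> nat \<Rightarrow> bool) \<Rightarrow> (nat \<times> nat) list \<Rightarrow> bool" where
  "agree T [] = True"
| "agree T ((i, i') # J) = (if agree2 T i i' J then agree T J else False)"

fun separated_from :: "(nat \<Rightarrow> nat \<Rightarrow> bool) \<Rightarrow> nat option list \<Rightarrow> nat option list list \<Rightarrow> bool" where
  "separated_from T p [] = True"
| "separated_from T p (p' # L) = (if covered p p' then separated_from T p L
     else if agree T (join p p') then False else separated_from T p L)"

fun separated :: "(nat \<Rightarrow> nat \<Rightarrow> bool) \<Rightarrow> nat option list list \<Rightarrow> bool" where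
  "separated T [] = True"
| "separated T (p # L) = (if separated_from T p L then separated T L else False)"

fun hits :: "'v \<Rightarrow> 'v list \<Rightarrow> (nat \<times> 'v) list list \<Rightarrow> nat option list list" where
  "hits x vs [] = []"
| "hits x vs (q # L) = (if fresh x q then hits x vs L else inverse_list vs q # hits x vs L)"

fun misses :: "'v \<Rightarrow> (nat \<times> 'v) list list \<Rightarrow> (nat \<times> 'v) list list" where
  "misses x [] = []"
| "misses x (q # L) = (if fresh x q then q # misses x L else misses x L)"

text \<open>The list \<open>r # [0..<r]\<close> starts with \<open>r\<close> because only triples containing \<open>r\<close> can disagree.\<close>

definition accepted :: "(nat \<Rightarrow> nat \<Rightarrow> bool) \<Rightarrow> nat \<Rightarrow> nat \<Rightarrow> (nat \<times> nat) list list \<Rightarrow> bool" where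
  "accepted T r a L = (if length (misses r L) \<le> a then separated T (hits r (r # [0..<r]) L) else False)"

text \<open>One search yields both data: its results avoiding \<open>r\<close> are the automorphisms
  of the switching class, and those using \<open>r\<close> are the candidates for further edges on
  \<open>T\<close> plus one vertex.\<close>

definition certificate :: "(nat \<Rightarrow> nat \<Rightarrow> bool) \<Rightarrow> nat \<Rightarrow> nat \<Rightarrow> bool" where
  "certificate T r a = accepted T r a (search (wild T r) [0..<Suc r] [0..<Suc r] r [])"

section \<open>Correctness of the certificate\<close>

lemma set_hits: "set (hits x vs L) = inverse_list vs ` {q \<in> set L. \<not> fresh x q}"
  by (induction L) auto

lemma misses_eq: "misses x L = filter (fresh x) L"
  by (induction L) auto

lemma separated_from_iff:
  "separated_from T p L \<longleftrightarrow> (\<forall>p'\<in>set L. covered p p' \<or> \<not> agree T (join p p'))"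
  by (induction L) auto

lemma separatedD:
  "separated T L \<Longrightarrow> p \<in> set L \<Longrightarrow> p' \<in> set L \<Longrightarrow> p = p' \<or>
    covered p p' \<or> \<not> agree T (join p p') \<or> covered p' p \<or> \<not> agree T (join p' p)"
  by (induction L) (auto simp: separated_from_iff split: if_splits)

lemma index_SomeD: "index x q = Some i \<Longrightarrow> (i, x) \<in> set q"
  by (induction q) (auto split: if_splits)

lemma index_None_iff: "index x q = None \<longleftrightarrow> x \<notin> snd ` set q"
  by (induction x q rule: index.induct) auto

lemma covered_inverse_list:
  "covered (inverse_list vs q) (inverse_list vs q') \<Longrightarrow> x \<in> set vs \<Longrightarrow> x \<in> snd ` set q \<Longrightarrow> x \<in> snd ` set q'"
proof (induction vs)
  case (Cons v vs)
  have "covered (inverse_list vs q) (inverse_list vs q') \<and> (index v q' = None \<longrightarrow> index v q = None)"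
    using Cons.prems(1) by (cases "index v q"; cases "index v q'") simp_all
  then show ?case using Cons unfolding index_None_iff by auto
qed simp

lemma set_join:
  "u \<in> set (join (inverse_list vs q) (inverse_list vs q')) \<Longrightarrow>
    \<exists>x\<in>set vs. (fst u, x) \<in> set q \<and> (snd u, x) \<in> set q'"
proof (induction vs)
  case (Cons v vs)
  then show ?case
    by (cases "index v q"; cases "index v q'") (auto dest: index_SomeD)
qed simp

text \<open>Distinct common vertices have distinct indices, as \<open>graph_list\<close> holds one
  pair per index. The triples found by \<open>not_agreeD\<close> thus consist of distinct indices,
  for which \<open>cyc\<close> is meaningful.\<close>

lemma distinct_join:
  assumes "distinct vs"
  shows "sorted_wrt (\<lambda>a b. fst a \<noteq> fst b) (join (inverse_list vs (graph_list 0 r f)) (inverse_list vs q))"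
  using assms
proof (induction vs)
  case (Cons v vs)
  let ?q = "graph_list 0 r f"
  have "fst u \<noteq> i" if "u \<in> set (join (inverse_list vs ?q) (inverse_list vs q))" "index v ?q = Some i" for u i
    using set_join[OF that(1)] index_SomeD[OF that(2)] Cons.prems by (auto simp: set_graph_list)
  then show ?case
    using Cons by (cases "index v ?q"; cases "index v q") fastforce+
qed simp

lemma not_agree3D: "\<not> agree3 T i i' j j' J \<Longrightarrow> \<exists>w\<in>set J. cyc T i j (fst w) \<noteq> cyc T i' j' (snd w)"
  by (induction J) (auto split: if_splits)

lemma not_agree2D:
  assumes "\<not> agree2 T i i' J" "sorted_wrt (\<lambda>a b. fst a \<noteq> fst b) J"
  shows "\<exists>v\<in>set J. \<exists>w\<in>set J. fst v \<noteq> fst w \<and> cyc T i (fst v) (fst w) \<noteq> cyc T i' (snd v) (snd w)"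
  using assms
proof (induction J)
  case (Cons v J)
  show ?case
  proof (cases "agree3 T i i' (fst v) (snd v) J")
    case True
    then have "\<not> agree2 T i i' J" using Cons.prems(1) by (cases v) simp
    then show ?thesis using Cons by auto
  next
    case False
    then obtain w where "w \<in> set J" "cyc T i (fst v) (fst w) \<noteq> cyc T i' (snd v) (snd w)"
      using not_agree3D by blast
    then show ?thesis using Cons.prems(2) by auto
  qed
qed simp

lemma not_agreeD:
  assumes "\<not> agree T J" "sorted_wrt (\<lambda>a b. fst a \<noteq> fst b) J"
  shows "\<exists>u\<in>set J. \<exists>v\<in>set J. \<exists>w\<in>set J. fst u \<noteq> fst v \<and> fst u \<noteq> fst w \<and> fst v \<noteq> fst w \<and>
    cyc T (fst u) (fst v) (fst w) \<noteq> cyc T (snd u) (snd v) (snd w)"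
  using assms
proof (induction J)
  case (Cons u J)
  show ?case
  proof (cases "agree2 T (fst u) (snd u) J")
    case True
    then have "\<not> agree T J" using Cons.prems(1) by (cases u) simp
    then have "\<exists>u\<in>set J. \<exists>v\<in>set J. \<exists>w\<in>set J. fst u \<noteq> fst v \<and> fst u \<noteq> fst w \<and> fst v \<noteq> fst w \<and>
        cyc T (fst u) (fst v) (fst w) \<noteq> cyc T (snd u) (snd v) (snd w)"
      using Cons.IH Cons.prems(2) by simp
    then show ?thesis by (meson list.set_intros(2))
  next
    case False
    then obtain v w where "v \<in> set J" "w \<in> set J" "fst v \<noteq> fst w"
        "cyc T (fst u) (fst v) (fst w) \<noteq> cyc T (snd u) (snd v) (snd w)"
      using not_agree2D Cons.prems(2) by fastforce
    then show ?thesis using Cons.prems(2) by auto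
  qed
qed simp

lemma graph_list_inj:
  assumes "graph_list 0 r f = graph_list 0 r g" "f \<in> extensional {..<r}" "g \<in> extensional {..<r}"
  shows "f = g"
proof (rule extensionalityI[OF assms(2,3)])
  show "f i = g i" if "i \<in> {..<r}" for i
    using assms(1) that by (auto simp: graph_list_def)
qed

lemma search_wildI:
  assumes "inj_on f {..<r}" "f ` {..<r} \<subseteq> {..r}"
    and "\<And>i j k. i < j \<Longrightarrow> j < k \<Longrightarrow> k < r \<Longrightarrow> f i \<noteq> r \<Longrightarrow> f j \<noteq> r \<Longrightarrow> f k \<noteq> r \<Longrightarrow>
      cyc T (f i) (f j) (f k) = cyc T i j k"
  shows "graph_list 0 r f \<in> set (search (wild T r) [0..<Suc r] [0..<Suc r] r [])"
proof -
  have "graph_list 0 r f \<in> set (search (wild T r) [0..<Suc r] [0..<Suc r] r (graph_list r r f))"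
    by (rule search_complete[OF assms(1)]) (use assms(2,3) in \<open>auto simp: wild_def\<close>)
  then show ?thesis by (simp add: graph_list_Nil)
qed

text \<open>Maps into \<open>{..<r}\<close> avoid \<open>r\<close>, so all automorphisms of the
  switching class occur among the \<open>misses\<close>.\<close>

lemma certificate_card_copies:
  assumes cert: "certificate T r a"
  shows "card (copies T r {..<r} T) \<le> a"
proof -
  let ?L = "search (wild T r) [0..<Suc r] [0..<Suc r] r []"
  let ?A = "misses r ?L"
  have "card (copies T r {..<r} T) \<le> card (set ?A)"
  proof (rule card_inj_on_le[of "graph_list 0 r"])
    show "inj_on (graph_list 0 r) (copies T r {..<r} T)"
      by (rule inj_onI) (metis graph_list_inj copiesD(3))
    show "graph_list 0 r ` copies T r {..<r} T \<subseteq> set ?A"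
    proof clarify
      fix f assume f: "f \<in> copies T r {..<r} T"
      note c = copiesD[OF f]
      have "graph_list 0 r f \<in> set ?L" by (rule search_wildI) (use c in fastforce)+
      moreover have "r \<notin> snd ` set (graph_list 0 r f)"
        unfolding snd_set_graph_list using c(2) by auto
      ultimately show "graph_list 0 r f \<in> set ?A" by (simp add: misses_eq fresh_iff)
    qed
  qed simp
  also have "\<dots> \<le> length ?A" by (rule card_length)
  also have "length ?A \<le> a"
    using cert unfolding certificate_def accepted_def by (auto split: if_splits)
  finally show ?thesis .
qed

lemma not_agree_join:
  assumes f: "inj_on f {..<r}" and g: "inj_on g {..<r}" and "distinct vs"
    and "\<not> agree T (join (inverse_list vs (graph_list 0 r f)) (inverse_list vs (graph_list 0 r g)))"
  obtains i j k i' j' k' where "{i, j, k, i', j', k'} \<subseteq> {..<r}" "distinct [i, j, k]"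
    "distinct [i', j', k']" "f i = g i'" "f j = g j'" "f k = g k'" "cyc T i j k \<noteq> cyc T i' j' k'"
proof -
  let ?J = "join (inverse_list vs (graph_list 0 r f)) (inverse_list vs (graph_list 0 r g))"
  obtain u v w where uvw: "u \<in> set ?J" "v \<in> set ?J" "w \<in> set ?J"
      "fst u \<noteq> fst v" "fst v \<noteq> fst w" "fst u \<noteq> fst w"
      "cyc T (fst u) (fst v) (fst w) \<noteq> cyc T (snd u) (snd v) (snd w)"
    using not_agreeD[OF assms(4) distinct_join[OF \<open>distinct vs\<close>]] by blast
  have J: "fst u < r \<and> snd u < r \<and> f (fst u) = g (snd u)" if "u \<in> set ?J" for u
    using set_join[OF that] by (auto simp: set_graph_list)
  have "snd a \<noteq> snd b" if "a \<in> set ?J" "b \<in> set ?J" "fst a \<noteq> fst b" for a b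
    using J[OF that(1)] J[OF that(2)] that(3) inj_onD[OF f, of "fst a" "fst b"] by auto
  then have "snd u \<noteq> snd v" "snd v \<noteq> snd w" "snd u \<noteq> snd w" using uvw by blast+
  then show ?thesis
    using uvw(4-) J[OF uvw(1)] J[OF uvw(2)] J[OF uvw(3)]
    by (intro that[of "fst u" "fst v" "fst w" "snd u" "snd v" "snd w"]) simp_all
qed

text \<open>\<open>separated\<close> compares two list entries in one order only. Assuming that
  neither image contains the other makes the order irrelevant.\<close>

lemma certificate_conflict:
  assumes cert: "certificate T r a"
    and f: "graph_list 0 r f \<in> set (search (wild T r) [0..<Suc r] [0..<Suc r] r [])"
      "inj_on f {..<r}" "f ` {..<r} \<subseteq> {..r}" "r \<in> f ` {..<r}"
    and g: "graph_list 0 r g \<in> set (search (wild T r) [0..<Suc r] [0..<Suc r] r [])"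
      "inj_on g {..<r}" "g ` {..<r} \<subseteq> {..r}" "r \<in> g ` {..<r}"
    and not_sub: "\<not> f ` {..<r} \<subseteq> g ` {..<r}" "\<not> g ` {..<r} \<subseteq> f ` {..<r}"
  obtains i j k i' j' k' where "{i, j, k, i', j', k'} \<subseteq> {..<r}" "distinct [i, j, k]"
    "distinct [i', j', k']" "f i = g i'" "f j = g j'" "f k = g k'" "cyc T i j k \<noteq> cyc T i' j' k'"
proof -
  let ?L = "search (wild T r) [0..<Suc r] [0..<Suc r] r []" and ?vs = "r # [0..<r]"
  let ?inv = "\<lambda>f. inverse_list ?vs (graph_list 0 r f)"
  have not_cov: "\<not> covered (?inv f) (?inv g)"
    if "f ` {..<r} \<subseteq> {..r}" "\<not> f ` {..<r} \<subseteq> g ` {..<r}" for f g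
  proof
    assume cov: "covered (?inv f) (?inv g)"
    have "x \<in> g ` {..<r}" if "x \<in> f ` {..<r}" for x
      using covered_inverse_list[OF cov, of x] that \<open>f ` {..<r} \<subseteq> {..r}\<close>
      unfolding snd_set_graph_list by fastforce
    then show False using that(2) by blast
  qed
  have dist: "distinct ?vs" by simp
  \<comment> \<open>Disposes of the case of \<open>separatedD\<close> in which the two list entries
    coincide.\<close>
  have covered_refl: "covered p p" for p
  proof (induction p)
    case (Cons u p)
    then show ?case by (cases u) simp_all
  qed simp
  have "\<not> fresh r (graph_list 0 r f)" "\<not> fresh r (graph_list 0 r g)"
    unfolding fresh_iff snd_set_graph_list using f(4) g(4) by blast+
  then have "?inv f \<in> set (hits r ?vs ?L)" "?inv g \<in> set (hits r ?vs ?L)"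
    using f(1) g(1) unfolding set_hits by blast+
  moreover have "separated T (hits r ?vs ?L)"
    using cert unfolding certificate_def accepted_def by (metis (full_types))
  moreover note not_cov[OF f(3) not_sub(1)] not_cov[OF g(3) not_sub(2)]
  ultimately have "\<not> agree T (join (?inv f) (?inv g)) \<or> \<not> agree T (join (?inv g) (?inv f))"
    using separatedD covered_refl by metis
  then show ?thesis
  proof
    assume "\<not> agree T (join (?inv f) (?inv g))"
    then show ?thesis by - (rule not_agree_join[OF f(2) g(2) dist], assumption, rule that)
  next
    assume "\<not> agree T (join (?inv g) (?inv f))"
    then obtain i j k i' j' k' where "{i, j, k, i', j', k'} \<subseteq> {..<r}" "distinct [i, j, k]"
        "distinct [i', j', k']" "g i = f i'" "g j = f j'" "g k = f k'" "cyc T i j k \<noteq> cyc T i' j' k'"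
      by (rule not_agree_join[OF g(2) f(2) dist])
    then show ?thesis by (intro that[of i' j' k' i j k]) simp_all
  qed
qed

section \<open>Counting copies in a concrete host\<close>

definition same_cyc :: "('a \<Rightarrow> 'a \<Rightarrow> bool) \<Rightarrow> (nat \<Rightarrow> nat \<Rightarrow> bool) \<Rightarrow> 'a \<Rightarrow> 'a \<Rightarrow> 'a \<Rightarrow> nat \<Rightarrow> nat \<Rightarrow> nat \<Rightarrow> bool" where
  "same_cyc S T x y z i j k = (cyc S x y z = cyc T i j k)"

lemma length_search_le_card_copies:
  assumes "distinct vs"
  shows "length (search (same_cyc S T) vs vs r []) \<le> card (copies T r (set vs) S)"
proof -
  let ?L = "search (same_cyc S T) vs vs r []"
  have "set ?L \<subseteq> graph_list 0 r ` copies T r (set vs) S"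
  proof
    fix q assume "q \<in> set ?L"
    then have "q \<in> set (search (same_cyc S T) vs vs r (graph_list r r f))" for f
      by (simp add: graph_list_Nil)
    from search_sound[OF this] obtain g where g: "q = graph_list 0 r g" "inj_on g {..<r}" "g ` {..<r} \<subseteq> set vs"
        "\<forall>i j k. i < j \<longrightarrow> j < k \<longrightarrow> k < r \<longrightarrow> cyc S (g i) (g j) (g k) = cyc T i j k"
      by (auto simp: same_cyc_def)
    then have "restrict g {..<r} \<in> copies T r (set vs) S"
      by (auto simp: copies_def inj_on_def)
    moreover have "graph_list 0 r (restrict g {..<r}) = q"
      unfolding g(1) by (simp add: graph_list_def)
    ultimately show "q \<in> graph_list 0 r ` copies T r (set vs) S" by blast
  qed
  then have "card (set ?L) \<le> card (copies T r (set vs) S)"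
    by (rule surj_card_le[rotated]) (simp add: finite_copies)
  moreover have "card (set ?L) = length ?L"
    using distinct_search[OF assms assms] by (intro distinct_card)
  ultimately show ?thesis by simp
qed

subsection \<open>Copy graphs contain no triangle\<close>

lemma cyc_comp: "cyc (\<lambda>x y. S (h x) (h y)) x y z = cyc S (h x) (h y) (h z)"
  by (simp add: cyc_def)

text \<open>Three edges on \<open>r + 1\<close> vertices omit one vertex each. The first edge is
  identified with \<open>T\<close> and its omitted vertex with \<open>r\<close>, so the other two
  become partial isomorphisms with different images. The certificate finds a triple to which they
  assign different \<open>cyc\<close> values, although the host has only one.\<close>

lemma copy_graph_triangle_free:
  assumes T: "tournament_on {..<r} T" and S: "tournament_on V S" and "2 \<le> r"
    and cert: "certificate T r a"
  shows "\<not> contains_copy (copy_graph T r V S) (r_triangle r)"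
proof
  assume "contains_copy (copy_graph T r V S) (r_triangle r)"
  then obtain u where u: "inj_on u {..r}" "u ` {..r} \<subseteq> V"
      "\<And>i. i \<in> {0, 1, 2} \<Longrightarrow> u ` ({..r} - {i}) \<in> (\<lambda>f. f ` {..<r}) ` copies T r V S"
    by (auto simp: contains_copy_def copy_graph_def r_triangle_def)
  define U where "U = u ` {..r}"
  have Ui: "u ` ({..r} - {i}) = U - {u i}" if "i \<in> {0, 1, 2}" for i
  proof -
    have "{i} \<subseteq> {..r}" using that \<open>2 \<le> r\<close> by auto
    then show ?thesis
      unfolding U_def using inj_on_image_set_diff[OF u(1) Diff_subset, of "{i}"]
      by (simp only: image_insert image_empty)
  qed
  have "\<exists>f\<in>copies T r V S. f ` {..<r} = U - {u i}" if "i \<in> {0, 1, 2}" for i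
    using u(3)[OF that] Ui[OF that] by force
  then obtain f0 f1 f2 where f0: "f0 \<in> copies T r V S" "f0 ` {..<r} = U - {u 0}"
    and f1: "f1 \<in> copies T r V S" "f1 ` {..<r} = U - {u 1}"
    and f2: "f2 \<in> copies T r V S" "f2 ` {..<r} = U - {u 2}"
    by (metis insertCI)
  have u_ne: "u 0 \<noteq> u 1" "u 0 \<noteq> u 2" "u 1 \<noteq> u 2"
    using \<open>2 \<le> r\<close> inj_onD[OF u(1), of 0 1] inj_onD[OF u(1), of 0 2] inj_onD[OF u(1), of 1 2] by auto
  have uU: "u 0 \<in> U" "u 1 \<in> U" "u 2 \<in> U" using \<open>2 \<le> r\<close> by (auto simp: U_def)
  define h where "h = f0(r := u 0)"
  have h_lt: "h i = f0 i" if "i < r" for i using that by (simp add: h_def)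
  have h_im: "h ` {..<r} = U - {u 0}" using f0(2) h_lt by (metis (mono_tags, lifting) image_cong lessThan_iff)
  have set_r: "{..r} = insert r {..<r}" by auto
  have h_bij: "bij_betw h {..r} U"
  proof -
    have "inj_on h {..<r}" using copiesD(1)[OF f0(1)] h_lt by (simp add: inj_on_def)
    moreover have "h r = u 0" by (simp add: h_def)
    ultimately show ?thesis
      using h_im uU(1) by (auto simp: bij_betw_def set_r)
  qed
  define h' where "h' = inv_into {..r} h"
  have h': "h' x \<le> r" "h (h' x) = x" if "x \<in> U" for x
    using that h_bij bij_betw_inv_into_right[OF h_bij, of x] inv_into_into[of x h "{..r}"]
    by (auto simp: h'_def bij_betw_def)
  have h'_inj: "inj_on h' U" by (rule inj_onI) (metis h'(2))
  have h'_r: "h' x = r \<longleftrightarrow> x = u 0" if "x \<in> U" for x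
  proof -
    have "h r = u 0" by (simp add: h_def)
    then show ?thesis using h'[OF that] h'[OF uU(1)] bij_betw_inv_into_left[OF h_bij, of r]
      by (metis atMost_iff h'_def order_refl)
  qed
  \<comment> \<open>The host in the coordinates \<open>{..r}\<close>: below \<open>r\<close> it has
    the \<open>cyc\<close> values of \<open>T\<close>, and nothing is known at \<open>r\<close>, as
    in \<open>wild\<close>.\<close>
  define S' where "S' x y = S (h x) (h y)" for x y
  have S'_T: "cyc S' x y z = cyc T x y z" if "x < r" "y < r" "z < r" "x \<noteq> y" "y \<noteq> z" "x \<noteq> z" for x y z
    using cyc_copies[OF T S f0(1) that] that by (simp add: S'_def[abs_def] cyc_comp h_lt)
  have U_V: "U \<subseteq> V" using u(2) by (simp add: U_def)
  have pull: "inj_on (h' \<circ> f) {..<r}" "(h' \<circ> f) ` {..<r} = {..r} - {h' v}"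
    "r \<in> (h' \<circ> f) ` {..<r}" "graph_list 0 r (h' \<circ> f) \<in> set (search (wild T r) [0..<Suc r] [0..<Suc r] r [])"
    "\<And>i j k. i < r \<Longrightarrow> j < r \<Longrightarrow> k < r \<Longrightarrow> i \<noteq> j \<Longrightarrow> j \<noteq> k \<Longrightarrow> i \<noteq> k \<Longrightarrow>
      cyc S' (h' (f i)) (h' (f j)) (h' (f k)) = cyc T i j k"
    if f: "f \<in> copies T r V S" "f ` {..<r} = U - {v}" and v: "v \<in> U" "v \<noteq> u 0" for f v
  proof -
    note c = copiesD[OF f(1)]
    have fU: "f i \<in> U" if "i < r" for i using f(2) that by blast
    have inj: "inj_on (h' \<circ> f) {..<r}"
      by (rule comp_inj_on[OF c(1)]) (rule inj_on_subset[OF h'_inj], use f(2) in blast)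
    have h'U: "h' ` U = {..r}"
      using bij_betw_inv_into[OF h_bij] by (simp add: h'_def bij_betw_def)
    have "(h' \<circ> f) ` {..<r} = h' ` (U - {v})" by (simp only: image_comp[symmetric] f(2))
    also have "\<dots> = {..r} - {h' v}"
      using inj_on_image_set_diff[OF h'_inj, of U "{v}"] v h'U by simp
    finally have im: "(h' \<circ> f) ` {..<r} = {..r} - {h' v}" .
    have "h' v \<noteq> r" using h'_r v by simp
    then have r_in: "r \<in> (h' \<circ> f) ` {..<r}" unfolding im by simp
    have cycs: "cyc S' (h' (f i)) (h' (f j)) (h' (f k)) = cyc T i j k"
      if "i < r" "j < r" "k < r" "i \<noteq> j" "j \<noteq> k" "i \<noteq> k" for i j k
      using cyc_copies[OF T S f(1) that] h'(2) fU that by (simp add: S'_def[abs_def] cyc_comp)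
    show "graph_list 0 r (h' \<circ> f) \<in> set (search (wild T r) [0..<Suc r] [0..<Suc r] r [])"
    proof (rule search_wildI[OF inj])
      show "(h' \<circ> f) ` {..<r} \<subseteq> {..r}" unfolding im by blast
      fix i j k assume ijk: "i < j" "j < k" "k < r"
        and ne: "(h' \<circ> f) i \<noteq> r" "(h' \<circ> f) j \<noteq> r" "(h' \<circ> f) k \<noteq> r"
      have d: "(h' \<circ> f) i \<noteq> (h' \<circ> f) j" "(h' \<circ> f) j \<noteq> (h' \<circ> f) k" "(h' \<circ> f) i \<noteq> (h' \<circ> f) k"
        using ijk inj_onD[OF inj, of i j] inj_onD[OF inj, of j k] inj_onD[OF inj, of i k] by auto
      have l: "(h' \<circ> f) i < r" "(h' \<circ> f) j < r" "(h' \<circ> f) k < r"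
        using ijk ne fU h'(1) by (auto simp: le_neq_implies_less)
      show "cyc T ((h' \<circ> f) i) ((h' \<circ> f) j) ((h' \<circ> f) k) = cyc T i j k"
        using S'_T[OF l d(1,2,3)] cycs[of i j k] ijk by simp
    qed
    show "inj_on (h' \<circ> f) {..<r}" "(h' \<circ> f) ` {..<r} = {..r} - {h' v}" "r \<in> (h' \<circ> f) ` {..<r}"
      by (fact inj im r_in)+
    show "cyc S' (h' (f i)) (h' (f j)) (h' (f k)) = cyc T i j k"
      if "i < r" "j < r" "k < r" "i \<noteq> j" "j \<noteq> k" "i \<noteq> k" for i j k
      using that by (rule cycs)
  qed
  note p1 = pull[OF f1 uU(2) u_ne(1)[symmetric]] and p2 = pull[OF f2 uU(3) u_ne(2)[symmetric]]
  have "h' (u 1) \<noteq> h' (u 2)" using inj_onD[OF h'_inj _ uU(2,3)] u_ne(3) by blast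
  then have not_sub: "\<not> (h' \<circ> f1) ` {..<r} \<subseteq> (h' \<circ> f2) ` {..<r}" "\<not> (h' \<circ> f2) ` {..<r} \<subseteq> (h' \<circ> f1) ` {..<r}"
    using h'(1)[OF uU(2)] h'(1)[OF uU(3)] unfolding p1(2) p2(2) by auto
  have fg_sub: "(h' \<circ> f1) ` {..<r} \<subseteq> {..r}" "(h' \<circ> f2) ` {..<r} \<subseteq> {..r}"
    unfolding p1(2) p2(2) by (rule Diff_subset)+
  obtain i j k i' j' k' where ijk: "{i, j, k, i', j', k'} \<subseteq> {..<r}" "distinct [i, j, k]" "distinct [i', j', k']"
      "(h' \<circ> f1) i = (h' \<circ> f2) i'" "(h' \<circ> f1) j = (h' \<circ> f2) j'" "(h' \<circ> f1) k = (h' \<circ> f2) k'"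
      "cyc T i j k \<noteq> cyc T i' j' k'"
    by (rule certificate_conflict[OF cert p1(4,1) fg_sub(1) p1(3) p2(4,1) fg_sub(2) p2(3) not_sub])
  have "cyc S' (h' (f2 i')) (h' (f2 j')) (h' (f2 k')) = cyc T i' j' k'"
    using ijk(1,3) by (intro p2(5)) auto
  moreover have "cyc S' (h' (f1 i)) (h' (f1 j)) (h' (f1 k)) = cyc T i j k"
    using ijk(1,2) by (intro p1(5)) auto
  ultimately show False using ijk(4-7) by simp
qed

text \<open>Some host has many copies by averaging, and each edge of its copy graph accounts for at
  most \<open>a\<close> of them.\<close>

lemma turan_density_r_triangle_ge:
  assumes T: "tournament_on {..<r} T" and "2 \<le> r" "0 < a" and cert: "certificate T r a"
  shows "fact r / (real a * 2 ^ ((r - 1) choose 2)) \<le> turan_density r (r_triangle r)"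
proof (rule turan_density_ge[OF \<open>2 \<le> r\<close>])
  show "edges (r_triangle r) \<noteq> {}" by (simp add: r_triangle_def)
  fix n assume "r \<le> n"
  obtain X where X: "(n choose r) * fact r
      \<le> 2 ^ ((r - 1) choose 2) * card (copies T r {..<n} (orient X))"
    using exists_many_copies[OF T, of n] \<open>2 \<le> r\<close> by auto
  let ?G = "copy_graph T r {..<n} (orient X)"
  have "card (copies T r {..<n} (orient X)) \<le> a * card (edges ?G)"
    by (rule card_copies_le[OF T tournament_orient _ certificate_card_copies[OF cert]]) simp
  also have "card (edges ?G) \<le> turan_number r (r_triangle r) n"
  proof (rule card_edges_le_turan_number)
    show "r_graph r ?G" by (rule r_graph_copy_graph) (use \<open>2 \<le> r\<close> in auto)
    show "card (verts ?G) = n" by (simp add: copy_graph_def)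
    show "\<not> contains_copy ?G (r_triangle r)"
      by (rule copy_graph_triangle_free[OF T tournament_orient \<open>2 \<le> r\<close> cert])
  qed
  finally have "card (copies T r {..<n} (orient X)) \<le> a * turan_number r (r_triangle r) n" by simp
  then have "(n choose r) * fact r \<le> 2 ^ ((r - 1) choose 2) * (a * turan_number r (r_triangle r) n)"
    using X by (meson le_trans mult_le_mono2)
  then have "real ((n choose r) * fact r) \<le> real (2 ^ ((r - 1) choose 2) * (a * turan_number r (r_triangle r) n))"
    by (rule of_nat_mono)
  then have "real (n choose r) * fact r \<le> real a * 2 ^ ((r - 1) choose 2) * real (turan_number r (r_triangle r) n)"
    by (simp add: mult_ac)
  then show "fact r / (real a * 2 ^ ((r - 1) choose 2)) * real (n choose r) \<le> real (turan_number r (r_triangle r) n)"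
    using \<open>0 < a\<close> by (simp add: field_simps)
qed

subsection \<open>The upper bound by counting pairs of edges\<close>

definition degree :: "'a hypergraph \<Rightarrow> 'a set \<Rightarrow> nat" where
  "degree G T = card {e \<in> edges G. T \<subseteq> e}"

lemma finite_edges: "r_graph r G \<Longrightarrow> finite (edges G)"
  by (rule finite_subset[of _ "Pow (verts G)"]) (auto simp: r_graph_def)

text \<open>Any three edges on \<open>r + 1\<close> vertices form the triangle, by
  \<open>r_triangle_unique\<close>.\<close>

lemma card_edges_in_le_2:
  assumes G: "r_graph r G" and free: "\<not> contains_copy G (r_triangle r)"
    and U: "U \<subseteq> verts G" "card U = r + 1"
  shows "card {e \<in> edges G. e \<subseteq> U} \<le> 2"
proof (rule ccontr)
  assume "\<not> ?thesis"
  then have "3 \<le> card {e \<in> edges G. e \<subseteq> U}" by simp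
  then obtain A where A: "A \<subseteq> {e \<in> edges G. e \<subseteq> U}" "card A = 3"
    by (meson obtain_subset_with_card_n)
  have "r_graph r (U, A)"
    using G A(1) U finite_subset[OF U(1)] by (fastforce simp: r_graph_def)
  then obtain f where f: "bij_betw f (verts (r_triangle r)) U" "A = (\<lambda>e. f ` e) ` edges (r_triangle r)"
    using r_triangle_unique[of r "(U, A)"] U A(2) by auto
  have "contains_copy G (r_triangle r)"
    unfolding contains_copy_def
    using f A(1) U(1) by (intro exI[of _ f]) (auto simp: bij_betw_def)
  then show False using free by contradiction
qed

context
  fixes r :: nat and G :: "'a hypergraph"
  assumes G: "r_graph r G"
begin

lemma sum_degree: "(\<Sum>T | T \<subseteq> verts G \<and> card T = r - 1. degree G T) = r * card (edges G)"
  unfolding degree_def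
proof (rule sum_multicount)
  show "finite {T. T \<subseteq> verts G \<and> card T = r - 1}"
    using G by (auto simp: r_graph_def)
  show "\<forall>e\<in>edges G. card {T \<in> {T. T \<subseteq> verts G \<and> card T = r - 1}. T \<subseteq> e} = r"
  proof
    fix e assume "e \<in> edges G"
    then have e: "e \<subseteq> verts G" "card e = r" "finite e" "2 \<le> r"
      using G by (auto simp: r_graph_def intro: finite_subset)
    then have "{T \<in> {T. T \<subseteq> verts G \<and> card T = r - 1}. T \<subseteq> e} = {T. T \<subseteq> e \<and> card T = r - 1}" by auto
    then show "card {T \<in> {T. T \<subseteq> verts G \<and> card T = r - 1}. T \<subseteq> e} = r"
      using e n_subsets[OF e(3), of "r - 1"] binomial_symmetric[of "r - 1" r] by simp
  qed
qed (rule finite_edges[OF G])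

text \<open>An edge inside \<open>insert x e\<close> other than \<open>e\<close> omits exactly one
  vertex of \<open>e\<close>, so it arises by exchanging that vertex for \<open>x\<close>.\<close>

lemma card_edges_in_insert:
  assumes e: "e \<in> edges G" and x: "x \<in> verts G - e"
  shows "card {e' \<in> edges G. e' \<subseteq> insert x e} = Suc (card {y \<in> e. insert x (e - {y}) \<in> edges G})"
proof -
  have fin: "finite e" "card e = r" using G e by (auto simp: r_graph_def intro: finite_subset)
  let ?A = "{y \<in> e. insert x (e - {y}) \<in> edges G}"
  have "{e' \<in> edges G. e' \<subseteq> insert x e} = insert e ((\<lambda>y. insert x (e - {y})) ` ?A)"
  proof (intro equalityI subsetI)
    fix e' assume "e' \<in> {e' \<in> edges G. e' \<subseteq> insert x e}"
    then have e': "e' \<in> edges G" "e' \<subseteq> insert x e" "card e' = r" using G by (auto simp: r_graph_def)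
    show "e' \<in> insert e ((\<lambda>y. insert x (e - {y})) ` ?A)"
    proof (cases "e' = e")
      case False
      have "card (insert x e - e') = 1"
        using e' fin x by (subst card_Diff_subset) (auto intro: finite_subset)
      then obtain y where y: "insert x e - e' = {y}" by (auto simp: card_1_singleton_iff)
      have "y \<noteq> x"
      proof
        assume "y = x"
        then have "e' \<subseteq> e" using y e'(2) by blast
        then show False using False card_subset_eq[OF fin(1), of e'] e'(3) fin(2) by simp
      qed
      moreover have "e' = insert x e - {y}" "y \<in> insert x e" using y e'(2) by blast+
      ultimately have "y \<in> e" "e' = insert x (e - {y})" by auto
      then show ?thesis using e'(1) by blast
    qed simp
  qed (use e in auto)
  moreover have "inj_on (\<lambda>y. insert x (e - {y})) ?A"
  proof (rule inj_onI)
    fix y z assume "y \<in> ?A" "z \<in> ?A" "insert x (e - {y}) = insert x (e - {z})"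
    then have yz: "y \<in> e" "z \<in> e" and eq: "insert x (e - {y}) = insert x (e - {z})" by auto
    from eq have "z \<notin> insert x (e - {y})" using x yz by auto
    then show "y = z" using yz by auto
  qed
  moreover have "e \<notin> (\<lambda>y. insert x (e - {y})) ` ?A" using x by blast
  ultimately show ?thesis using fin by (simp add: card_image)
qed

lemma degree_edge_minus:
  assumes e: "e \<in> edges G" and y: "y \<in> e"
  shows "degree G (e - {y}) = Suc (card {x \<in> verts G - e. insert x (e - {y}) \<in> edges G})"
proof -
  have fin: "finite e" "card e = r" "e \<subseteq> verts G" "finite (verts G)"
    using G e by (auto simp: r_graph_def intro: finite_subset)
  let ?A = "{x \<in> verts G - e. insert x (e - {y}) \<in> edges G}"
  have "{e' \<in> edges G. e - {y} \<subseteq> e'} = insert e ((\<lambda>x. insert x (e - {y})) ` ?A)"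
  proof (intro equalityI subsetI)
    fix e' assume "e' \<in> {e' \<in> edges G. e - {y} \<subseteq> e'}"
    then have e': "e' \<in> edges G" "e - {y} \<subseteq> e'" "card e' = r" "e' \<subseteq> verts G" "finite e'"
      using G by (auto simp: r_graph_def intro: finite_subset)
    have "0 < r" using fin y card_gt_0_iff by blast
    then have "card (e' - (e - {y})) = 1"
      using e' fin y by (subst card_Diff_subset) auto
    then obtain x where x: "e' - (e - {y}) = {x}" by (auto simp: card_1_singleton_iff)
    then have e'_eq: "e' = insert x (e - {y})" using e'(2) by blast
    show "e' \<in> insert e ((\<lambda>x. insert x (e - {y})) ` ?A)"
    proof (cases "x = y")
      case True
      then show ?thesis using e'_eq y by auto
    next
      case False
      then have "x \<in> ?A" using x e' e'_eq by auto
      then show ?thesis using e'_eq by blast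
    qed
  qed (use e in auto)
  moreover have "inj_on (\<lambda>x. insert x (e - {y})) ?A" by (intro inj_onI) blast
  moreover have "e \<notin> (\<lambda>x. insert x (e - {y})) ` ?A" by blast
  ultimately show ?thesis using fin by (simp add: degree_def card_image)
qed

text \<open>Double counting of the exchanges of some \<open>y\<close> in \<open>e\<close> for an
  outside vertex \<open>x\<close> that produce an edge. The extra \<open>r\<close> stems from
  \<open>e\<close> itself, counted once in each degree.\<close>

lemma sum_degree_edge:
  assumes e: "e \<in> edges G"
  shows "(\<Sum>y\<in>e. degree G (e - {y})) = r + (\<Sum>x\<in>verts G - e. card {y \<in> e. insert x (e - {y}) \<in> edges G})"
proof -
  have fin: "finite e" "card e = r" "finite (verts G)"
    using G e by (auto simp: r_graph_def intro: finite_subset)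
  have "(\<Sum>y\<in>e. degree G (e - {y})) = (\<Sum>y\<in>e. Suc (card {x \<in> verts G - e. insert x (e - {y}) \<in> edges G}))"
    by (intro sum.cong refl) (rule degree_edge_minus[OF e])
  also have "\<dots> = r + (\<Sum>y\<in>e. card {x \<in> verts G - e. insert x (e - {y}) \<in> edges G})"
    using fin by (simp add: sum_Suc)
  also have "(\<Sum>y\<in>e. card {x \<in> verts G - e. insert x (e - {y}) \<in> edges G})
      = (\<Sum>x\<in>verts G - e. card {y \<in> e. insert x (e - {y}) \<in> edges G})"
    by (rule sum_multicount_gen) (use fin in auto)
  finally show ?thesis .
qed

text \<open>A set \<open>T\<close> contributes its degree once for every edge containing it, and the
  subsets of \<open>e\<close> of size \<open>r - 1\<close> are the sets
  \<open>e - {y}\<close>.\<close>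

lemma sum_degree_square:
  "(\<Sum>T | T \<subseteq> verts G \<and> card T = r - 1. degree G T * degree G T) = (\<Sum>e\<in>edges G. \<Sum>y\<in>e. degree G (e - {y}))"
proof -
  let ?T = "{T. T \<subseteq> verts G \<and> card T = r - 1}"
  have fin: "finite ?T" "finite (edges G)" using G finite_edges[OF G] by (auto simp: r_graph_def)
  have "(\<Sum>T\<in>?T. degree G T * degree G T) = (\<Sum>T\<in>?T. \<Sum>e | e \<in> edges G \<and> T \<subseteq> e. degree G T)"
    by (simp add: degree_def)
  also have "\<dots> = (\<Sum>e\<in>edges G. \<Sum>T | T \<in> ?T \<and> T \<subseteq> e. degree G T)"
    by (rule sum.swap_restrict[OF fin])
  also have "\<dots> = (\<Sum>e\<in>edges G. \<Sum>y\<in>e. degree G (e - {y}))"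
  proof (rule sum.cong[OF refl])
    fix e assume "e \<in> edges G"
    then have e: "e \<subseteq> verts G" "card e = r" "finite e" "2 \<le> r"
      using G by (auto simp: r_graph_def intro: finite_subset)
    have "{T. T \<in> ?T \<and> T \<subseteq> e} = (\<lambda>y. e - {y}) ` e"
    proof (intro equalityI subsetI)
      fix T assume "T \<in> {T. T \<in> ?T \<and> T \<subseteq> e}"
      then have T: "T \<subseteq> e" "card T = r - 1" by auto
      then have "card (e - T) = 1" using e by (subst card_Diff_subset) (auto intro: finite_subset)
      then obtain y where "e - T = {y}" by (auto simp: card_1_singleton_iff)
      then have "y \<in> e" "T = e - {y}" using T(1) by blast+
      then show "T \<in> (\<lambda>y. e - {y}) ` e" by blast
    qed (use e in auto)
    then show "(\<Sum>T | T \<in> ?T \<and> T \<subseteq> e. degree G T) = (\<Sum>y\<in>e. degree G (e - {y}))"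
      by (simp add: sum.reindex[OF inj_on_complement])
  qed
  finally show ?thesis .
qed

context
  assumes free: "\<not> contains_copy G (r_triangle r)"
begin

text \<open>Two successful exchanges together with \<open>e\<close> would be three edges inside
  \<open>insert x e\<close>.\<close>

lemma card_exchange_le_1:
  assumes "e \<in> edges G" "x \<in> verts G - e"
  shows "card {y \<in> e. insert x (e - {y}) \<in> edges G} \<le> 1"
proof -
  have "e \<subseteq> verts G" "card e = r" "finite e"
    using G assms by (auto simp: r_graph_def intro: finite_subset)
  then have "card {e' \<in> edges G. e' \<subseteq> insert x e} \<le> 2"
    using assms by (intro card_edges_in_le_2[OF G free]) auto
  then show ?thesis using card_edges_in_insert[OF assms] by simp
qed

lemma sum_degree_edge_le:
  assumes e: "e \<in> edges G"
  shows "(\<Sum>y\<in>e. degree G (e - {y})) \<le> card (verts G)"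
proof -
  have fin: "e \<subseteq> verts G" "finite e" "card e = r" "finite (verts G)"
    using G e by (auto simp: r_graph_def intro: finite_subset)
  have "(\<Sum>x\<in>verts G - e. card {y \<in> e. insert x (e - {y}) \<in> edges G}) \<le> (\<Sum>x\<in>verts G - e. 1)"
    by (rule sum_mono) (rule card_exchange_le_1[OF e])
  also have "\<dots> = card (verts G) - r" using fin by (simp add: card_Diff_subset)
  finally show ?thesis using sum_degree_edge[OF e] card_mono[OF fin(4,1)] fin(3) by simp
qed

text \<open>Expanding the square, \<open>sum_degree_edge_le\<close> bounds the quadratic term and
  \<open>sum_degree\<close> evaluates the linear one. Where the bound is 0, every degree equals
  \<open>d\<close>.\<close>

lemma sum_degree_deviation_le:
  "(\<Sum>T | T \<subseteq> verts G \<and> card T = r - 1. (int (degree G T) - d)\<^sup>2)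
    \<le> (int (card (verts G)) - 2 * d * int r) * int (card (edges G)) + d\<^sup>2 * int (card (verts G) choose (r - 1))"
proof -
  let ?T = "{T. T \<subseteq> verts G \<and> card T = r - 1}"
  have "(\<Sum>T\<in>?T. degree G T * degree G T) \<le> (\<Sum>e\<in>edges G. card (verts G))"
    unfolding sum_degree_square by (rule sum_mono) (rule sum_degree_edge_le)
  then have sq: "(\<Sum>T\<in>?T. int (degree G T) * int (degree G T)) \<le> int (card (verts G)) * int (card (edges G))"
    by (simp only: of_nat_sum[symmetric] of_nat_mult[symmetric] of_nat_le_iff) (simp add: mult.commute)
  have lin: "(\<Sum>T\<in>?T. int (degree G T)) = int r * int (card (edges G))"
    using arg_cong[OF sum_degree, of int] by simp
  have cT: "card ?T = card (verts G) choose (r - 1)"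
    using n_subsets G by (auto simp: r_graph_def)
  have "(\<Sum>T\<in>?T. (int (degree G T) - d)\<^sup>2)
      = (\<Sum>T\<in>?T. int (degree G T) * int (degree G T) - 2 * d * int (degree G T) + d\<^sup>2)"
    by (intro sum.cong refl) (simp add: power2_eq_square algebra_simps)
  also have "\<dots> = (\<Sum>T\<in>?T. int (degree G T) * int (degree G T))
      - 2 * d * (\<Sum>T\<in>?T. int (degree G T)) + int (card ?T) * d\<^sup>2"
    by (simp add: sum.distrib sum_subtractf sum_distrib_left)
  finally show ?thesis using sq unfolding lin cT by (simp add: algebra_simps)
qed

end

text \<open>Here \<open>sum_degree_edge\<close> leaves no slack in \<open>card_exchange_le_1\<close>.\<close>

lemma spans_0_or_2:
  assumes free: "\<not> contains_copy G (r_triangle r)" and n: "card (verts G) = 2 * r"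
    and deg: "\<And>T. T \<subseteq> verts G \<Longrightarrow> card T = r - 1 \<Longrightarrow> degree G T = 2"
    and S: "S \<subseteq> verts G" "card S = r + 1"
  shows "spans G S 0 \<or> spans G S 2"
proof (cases "\<exists>e\<in>edges G. e \<subseteq> S")
  case True
  then obtain e where e: "e \<in> edges G" "e \<subseteq> S" by blast
  have fin: "e \<subseteq> verts G" "finite e" "card e = r" "finite (verts G)" "finite S"
    using G e S by (auto simp: r_graph_def intro: finite_subset)
  then have "card (S - e) = 1" using e(2) S by (simp add: card_Diff_subset)
  then obtain x where x: "S - e = {x}" by (auto simp: card_1_singleton_iff)
  then have S_eq: "S = insert x e" and xV: "x \<in> verts G - e" using e(2) S(1) by blast+
  let ?c = "\<lambda>x. card {y \<in> e. insert x (e - {y}) \<in> edges G}"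
  have "degree G (e - {y}) = 2" if "y \<in> e" for y
    using that fin by (intro deg) auto
  then have "2 * r = r + (\<Sum>x\<in>verts G - e. ?c x)"
    using sum_degree_edge[OF e(1)] fin by simp
  moreover have "card (verts G - e) = r" using fin n by (simp add: card_Diff_subset)
  \<comment> \<open>The \<open>r\<close> outside vertices contribute \<open>r\<close> in total and
    at most 1 each, hence exactly 1 each. The bound 1 also keeps the subtraction of naturals
    exact.\<close>
  ultimately have "(\<Sum>x\<in>verts G - e. 1 - ?c x) = 0"
    using card_exchange_le_1[OF free e(1)] by (subst sum_subtractf_nat) auto
  then have "1 \<le> ?c x" using xV fin(4) by auto
  then have "?c x = 1" using card_exchange_le_1[OF free e(1) xV] by simp
  then show ?thesis using card_edges_in_insert[OF e(1) xV] by (simp add: spans_def S_eq)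
next
  case False
  then have "{e \<in> edges G. e \<subseteq> S} = {}" by blast
  then show ?thesis unfolding spans_def by (metis card.empty)
qed

end

subsection \<open>The templates and the Paley tournament\<close>

text \<open>In \<open>paley12\<close> the vertex 0 dominates the residues \<open>1, \<dots>, 11\<close> modulo 11, among which \<open>x\<close> dominates \<open>y\<close>
  if \<open>y - x\<close> is a nonzero square. The rows are curried so that rewriting copies a single row per lookup.\<close>

fun T6 :: "nat \<Rightarrow> nat \<Rightarrow> bool" where
  "T6 0 = (!) [False, True, True, True, True, True]"
| "T6 (Suc 0) = (!) [False, False, False, True, False, True]"
| "T6 (Suc (Suc 0)) = (!) [False, True, False, False, False, False]"
| "T6 (Suc (Suc (Suc 0))) = (!) [False, False, True, False, False, False]"
| "T6 (Suc (Suc (Suc (Suc 0)))) = (!) [False, True, True, True, False, False]"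
| "T6 (Suc (Suc (Suc (Suc (Suc 0))))) = (!) [False, False, True, True, True, False]"

text \<open>As in \<open>T6\<close>, vertex 0 dominates all others; every switching class has such a
  representative.\<close>

fun T7 :: "nat \<Rightarrow> nat \<Rightarrow> bool" where
  "T7 0 = (!) [False, True, True, True, True, True, True]"
| "T7 (Suc 0) = (!) [False, False, False, False, False, False, True]"
| "T7 (Suc (Suc 0)) = (!) [False, True, False, False, True, False, False]"
| "T7 (Suc (Suc (Suc 0))) = (!) [False, True, True, False, False, False, False]"
| "T7 (Suc (Suc (Suc (Suc 0)))) = (!) [False, True, False, True, False, False, False]"
| "T7 (Suc (Suc (Suc (Suc (Suc 0))))) = (!) [False, True, True, True, True, False, False]"
| "T7 (Suc (Suc (Suc (Suc (Suc (Suc 0)))))) = (!) [False, False, True, True, True, True, False]"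

fun T8 :: "nat \<Rightarrow> nat \<Rightarrow> bool" where
  "T8 0 = (!) [False, True, True, True, True, True, True, True]"
| "T8 (Suc 0) = (!) [False, False, True, False, True, False, False, True]"
| "T8 (Suc (Suc 0)) = (!) [False, False, False, False, False, True, False, False]"
| "T8 (Suc (Suc (Suc 0))) = (!) [False, True, True, False, False, False, False, False]"
| "T8 (Suc (Suc (Suc (Suc 0)))) = (!) [False, False, True, True, False, False, False, False]"
| "T8 (Suc (Suc (Suc (Suc (Suc 0))))) = (!) [False, True, False, True, True, False, False, False]"
| "T8 (Suc (Suc (Suc (Suc (Suc (Suc 0)))))) = (!) [False, True, True, True, True, True, False, False]"
| "T8 (Suc (Suc (Suc (Suc (Suc (Suc (Suc 0))))))) = (!) [False, False, True, True, True, True, True, False]"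

fun paley12 :: "nat \<Rightarrow> nat \<Rightarrow> bool" where
  "paley12 0 = (!) [False, True, True, True, True, True, True, True, True, True, True, True]"
| "paley12 (Suc 0) = (!) [False, False, True, False, True, True, True, False, False, False, True, False]"
| "paley12 (Suc (Suc 0)) = (!) [False, False, False, True, False, True, True, True, False, False, False, True]"
| "paley12 (Suc (Suc (Suc 0))) = (!) [False, True, False, False, True, False, True, True, True, False, False, False]"
| "paley12 (Suc (Suc (Suc (Suc 0)))) = (!) [False, False, True, False, False, True, False, True, True, True, False, False]"
| "paley12 (Suc (Suc (Suc (Suc (Suc 0))))) = (!) [False, False, False, True, False, False, True, False, True, True, True, False]"
| "paley12 (Suc (Suc (Suc (Suc (Suc (Suc 0)))))) = (!) [False, False, False, False, True, False, False, True, False, True, True, True]"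
| "paley12 (Suc (Suc (Suc (Suc (Suc (Suc (Suc 0))))))) = (!) [False, True, False, False, False, True, False, False, True, False, True, True]"
| "paley12 (Suc (Suc (Suc (Suc (Suc (Suc (Suc (Suc 0)))))))) = (!) [False, True, True, False, False, False, True, False, False, True, False, True]"
| "paley12 (Suc (Suc (Suc (Suc (Suc (Suc (Suc (Suc (Suc 0))))))))) = (!) [False, True, True, True, False, False, False, True, False, False, True, False]"
| "paley12 (Suc (Suc (Suc (Suc (Suc (Suc (Suc (Suc (Suc (Suc 0)))))))))) = (!) [False, False, True, True, True, False, False, False, True, False, False, True]"
| "paley12 (Suc (Suc (Suc (Suc (Suc (Suc (Suc (Suc (Suc (Suc (Suc 0))))))))))) = (!) [False, True, False, True, True, True, False, False, False, True, False, False]"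

lemma tournament_T6: "tournament_on {..<6} T6"
  by code_simp

lemma tournament_T7: "tournament_on {..<7} T7"
  by code_simp

lemma tournament_T8: "tournament_on {..<8} T8"
  by code_simp

lemma tournament_paley12: "tournament_on {..<12} paley12"
  by code_simp

lemma certificate_T6: "certificate T6 6 5"
  by code_simp

lemma certificate_T7: "certificate T7 7 9"
  by code_simp

lemma certificate_T8: "certificate T8 8 1"
  by code_simp

text \<open>1320 = 5 * 264: an edge carries at most 5 copies of \<open>T6\<close>, so the host has
  at least 264 edges.\<close>

lemma length_search_paley12:
  "length (search (same_cyc paley12 T6) [0..<12] [0..<12] 6 []) = 1320"
  by code_simp

section \<open>The density bounds and the design on 12 vertices\<close>

theorem theorem1p1:
  shows "9 / 64 \<le> turan_density 6 (r_triangle 6)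
    \<and> 35 / 2 ^ 11 \<le> turan_density 7 (r_triangle 7)
    \<and> 315 / 2 ^ 14 \<le> turan_density 8 (r_triangle 8)
    \<and> (\<exists>D :: nat hypergraph. design 5 12 6 2 D \<and>
         (\<forall>S. S \<subseteq> verts D \<and> card S = 7 \<longrightarrow> spans D S 0 \<or> spans D S 2))
    \<and> turan_number 6 (r_triangle 6) 12 = 264"
proof -
  \<comment> \<open>The three bounds are 6! / (5 * 2^10), 7! / (9 * 2^15) and 8! / 2^21 in lowest
    terms.\<close>
  have d6: "9 / 64 \<le> turan_density 6 (r_triangle 6)"
    using turan_density_r_triangle_ge[OF tournament_T6 _ _ certificate_T6]
    by (simp add: fact_numeral numeral_eq_Suc choose_two)
  have d7: "35 / 2 ^ 11 \<le> turan_density 7 (r_triangle 7)"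
    using turan_density_r_triangle_ge[OF tournament_T7 _ _ certificate_T7]
    by (simp add: fact_numeral choose_two)
  have d8: "315 / 2 ^ 14 \<le> turan_density 8 (r_triangle 8)"
    using turan_density_r_triangle_ge[OF tournament_T8 _ _ certificate_T8]
    by (simp add: fact_numeral choose_two)
  have free_le: "card (edges G) \<le> 264 \<and> (card (edges G) = 264 \<longrightarrow>
      (\<forall>T. T \<subseteq> verts G \<and> card T = 5 \<longrightarrow> degree G T = 2))"
    if G: "r_graph 6 G" "card (verts G) = 12" "\<not> contains_copy G (r_triangle 6)" for G :: "nat hypergraph"
  proof -
    let ?T = "{T. T \<subseteq> verts G \<and> card T = 5}"
    have fin: "finite ?T" using G(1) by (auto simp: r_graph_def)
    \<comment> \<open>For 264 edges the 792 five-sets have average degree 6 * 264 / 792 = 2, whence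
      \<open>d = 2\<close>. The deviation bound is then 4 * 792 + (12 - 24) *
      \<open>card (edges G)\<close>, which vanishes at 264 edges.\<close>
    have "(12 choose 5 :: nat) = 792" by (simp add: numeral_eq_Suc)
    then have sq: "(\<Sum>T\<in>?T. (int (degree G T) - 2)\<^sup>2) \<le> 3168 - 12 * int (card (edges G))"
      using sum_degree_deviation_le[OF G(1,3), of 2] G(2) by simp
    moreover have "0 \<le> (\<Sum>T\<in>?T. (int (degree G T) - 2)\<^sup>2)" by (rule sum_nonneg) simp
    moreover have "\<forall>T\<in>?T. (int (degree G T) - 2)\<^sup>2 = 0" if "card (edges G) = 264"
      using sq that sum_nonneg_eq_0_iff[OF fin, of "\<lambda>T. (int (degree G T) - 2)\<^sup>2"]
        \<open>0 \<le> _\<close> by simp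
    ultimately show ?thesis by auto
  qed
  define D where "D = copy_graph T6 6 {..<12} paley12"
  have D: "r_graph 6 D" "card (verts D) = 12" "\<not> contains_copy D (r_triangle 6)"
    using copy_graph_triangle_free[OF tournament_T6 tournament_paley12 _ certificate_T6]
    unfolding D_def by (simp_all add: r_graph_copy_graph) (simp add: copy_graph_def)
  have "1320 \<le> card (copies T6 6 {..<12} paley12)"
    using length_search_le_card_copies[of "[0..<12]" paley12 T6 6] length_search_paley12
    by (simp add: atLeast0LessThan)
  also have "\<dots> \<le> 5 * card (edges D)"
    unfolding D_def
    by (rule card_copies_le[OF tournament_T6 tournament_paley12 _ certificate_card_copies[OF certificate_T6]]) simp
  \<comment> \<open>The number of copies gives at least 264 edges and \<open>free_le\<close> at most
    264.\<close>
  finally have cD: "card (edges D) = 264" using free_le[OF D] by simp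
  then have deg: "degree D T = 2" if "T \<subseteq> verts D" "card T = 5" for T
    using free_le[OF D] that by blast
  have "design 5 12 6 2 D"
    using D deg by (auto simp: design_def degree_def)
  moreover have "spans D S 0 \<or> spans D S 2" if "S \<subseteq> verts D" "card S = 7" for S
    by (rule spans_0_or_2[OF D(1,3)]) (use D(2) deg that in auto)
  moreover have "turan_number 6 (r_triangle 6) 12 = 264"
  proof (rule antisym)
    show "264 \<le> turan_number 6 (r_triangle 6) 12"
      using card_edges_le_turan_number[OF D] cD by simp
    have "edges (r_triangle 6) \<noteq> {}" by (simp add: r_triangle_def)
    then obtain G :: "nat hypergraph" where G: "r_graph 6 G" "card (verts G) = 12"
        "\<not> contains_copy G (r_triangle 6)" "card (edges G) = turan_number 6 (r_triangle 6) 12"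
      using turan_number_attained[of 6 "r_triangle 6" 12] by auto
    then show "turan_number 6 (r_triangle 6) 12 \<le> 264" using free_le[OF G(1-3)] by simp
  qed
  ultimately show ?thesis using d6 d7 d8 by blast
qed

end
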